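(* Let $A$ be a bounded band operator on $\ell^2(\mathbb{Z})$, in its block-tridiagonal representation on $\ell^2(\mathbb{Z},\mathbb{C}^d)$ with sub- and superdiagonals $\alpha,\gamma$, and for $n\in\mathbb{N}$ let $$\varepsilon_n = 2(\|\alpha\|_\infty+\|\gamma\|_\infty)\sin\frac{\pi}{2(n+1)}.$$ Let $\varepsilon>0$. Then both sequences of sets $$\bigcup_{k\in\mathbb{Z}}\mathrm{spec}_{\varepsilon}(AP_{n,k},A^*P_{n,k})\qquad\text{and}\qquad \bigcup_{k\in\mathbb{Z}}\mathrm{spec}_{\varepsilon+\varepsilon_n}(AP_{n,k},A^*P_{n,k})$$ (which are respectively subsets and supersets of $\mathrm{spec}_\varepsilon A$) converge to $\mathrm{spec}_\varepsilon A$ in the Hausdorff distance as $n\to\infty$.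
   Context: Band operator: a bounded linear operator on $\ell^2(\mathbb{Z})$ (complex sequences, Euclidean norm) given by a bi-infinite matrix $(A_{i,j})$ with finite bandwidth $b$, where $b$ is the largest $|i-j|$ over all positions with $A_{i,j}\neq 0$; each diagonal is a bounded sequence. Block-tridiagonal representation: if $b\le 1$ put $d=1$; if $b>1$ put $d=b+1$ and group the indices in $\mathbb{Z}$ into consecutive blocks of length $d$, identifying $\ell^2(\mathbb{Z})$ with $\ell^2(\mathbb{Z},\mathbb{C}^d)$. Then $A$ is a tridiagonal matrix whose entries $A_{i,j}$ are $d\times d$ complex matrices (scalars if $d=1$). From here on, all indices, columns and supports refer to this representation. Put $\alpha_i=A_{i+1,i}$, $\gamma_i=A_{i-1,i}$, $\|\alpha\|_\infty=\sup_i\|\alpha_i\|$, $\|\gamma\|_\infty=\sup_i\|\gamma_i\|$, with the operator norm induced by the Euclidean norm on $\mathbb{C}^d$. $A^*$ denotes the Banach space adjoint (the transpose matrix, without complex conjugation), so $(\lambda I)^*=\lambda I$. Lower norm: $\nu(B)=\inf\{\|Bx\|:\|x\|=1\}$, the infimum being over $x$ in the domain space of $B$. Pseudospectrum: $\mathrm{spec}_\varepsilon A=\{\lambda\in\mathbb{C}:\|(A-\lambda I)^{-1}\|>1/\varepsilon\}$ for $\varepsilon>0$, with $\|B^{-1}\|:=\infty$ if $B$ is not invertible. For $n\in\mathbb{N}=\{1,2,\dots\}$ and $k\in\mathbb{Z}$, $BP_{n,k}$ denotes the restriction of $B$ to the sequences supported in $k+\{1,\dots,n\}$, i.e. the matrix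 formed by columns $k+1,\dots,k+n$ of $B$. For $B=A$ or $B=A^*$, $\mathrm{spec}_\varepsilon(BP_{n,k}):=\{\lambda\in\mathbb{C}:\nu((B-\lambda I)P_{n,k})<\varepsilon\}$. Finally $\mathrm{spec}_\varepsilon(AP_{n,k},A^*P_{n,k}):=\mathrm{spec}_\varepsilon(AP_{n,k})\cup\mathrm{spec}_\varepsilon(A^*P_{n,k})$. Hausdorff distance of nonempty bounded sets $S,T\subset\mathbb{C}$ (not necessarily closed): $\max\{\sup_{s\in S}\mathrm{dist}(s,T),\sup_{t\in T}\mathrm{dist}(t,S)\}$. Finitely many initial terms of the sequence of subsets may be empty; convergence concerns large $n$. *)

theory Defs
  imports "HOL-Analysis.Analysis"
begin

section \<open>The space of square-summable bi-infinite complex sequences\<close>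

typedef ell2 = "{x :: int \<Rightarrow> complex. (\<lambda>i. (cmod (x i))\<^sup>2) summable_on UNIV}"
  morphisms seq Abs_ell2
  by (rule exI[of _ "\<lambda>_. 0"]) simp

lemma seq_summable: "(\<lambda>i. (cmod (seq x i))\<^sup>2) summable_on UNIV"
  using seq[of x] by simp

lemma seq_Abs_ell2:
  assumes "(\<lambda>i. (cmod (f i))\<^sup>2) summable_on UNIV"
  shows "seq (Abs_ell2 f) = f"
  using Abs_ell2_inverse assms by simp

lemma ell2_eqI: "(\<And>i. seq x i = seq y i) \<Longrightarrow> x = y"
  by (metis ext seq_inject)

lemma summable_sq_add:
  fixes f g :: "int \<Rightarrow> complex"
  assumes "(\<lambda>i. (cmod (f i))\<^sup>2) summable_on UNIV" "(\<lambda>i. (cmod (g i))\<^sup>2) summable_on UNIV"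
  shows "(\<lambda>i. (cmod (f i + g i))\<^sup>2) summable_on UNIV"
proof (rule summable_on_comparison_test)
  show "(\<lambda>i. 2 * (cmod (f i))\<^sup>2 + 2 * (cmod (g i))\<^sup>2) summable_on UNIV"
    by (intro summable_on_add summable_on_cmult_right assms)
  fix i
  have "(cmod (f i + g i))\<^sup>2 \<le> (cmod (f i) + cmod (g i))\<^sup>2"
    by (intro power_mono norm_triangle_ineq norm_ge_zero)
  also have "\<dots> \<le> 2 * (cmod (f i))\<^sup>2 + 2 * (cmod (g i))\<^sup>2"
    using sum_squares_bound[of "cmod (f i)" "cmod (g i)"] by (simp add: power2_sum)
  finally show "(cmod (f i + g i))\<^sup>2 \<le> 2 * (cmod (f i))\<^sup>2 + 2 * (cmod (g i))\<^sup>2" .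
qed simp

lemma summable_sq_mult:
  fixes f :: "int \<Rightarrow> complex"
  assumes "(\<lambda>i. (cmod (f i))\<^sup>2) summable_on UNIV"
  shows "(\<lambda>i. (cmod (a * f i))\<^sup>2) summable_on UNIV"
  by (simp add: norm_mult power_mult_distrib summable_on_cmult_right assms)

instantiation ell2 :: real_normed_vector
begin

definition "0 = Abs_ell2 (\<lambda>_. 0)"
definition "x + y = Abs_ell2 (\<lambda>i. seq x i + seq y i)"
definition "- x = Abs_ell2 (\<lambda>i. - seq x i)"
definition "x - y = Abs_ell2 (\<lambda>i. seq x i - seq y i)"
definition "r *\<^sub>R x = Abs_ell2 (\<lambda>i. r *\<^sub>R seq x i)"
definition "norm x = sqrt (\<Sum>\<^sub>\<infinity>i. (cmod (seq x i))\<^sup>2)"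
definition "sgn x = inverse (norm x) *\<^sub>R (x :: ell2)"
definition "dist x y = norm (x - y :: ell2)"
definition "uniformity = (INF e\<in>{0 <..}. principal {(x :: ell2, y). dist x y < e})"
definition "open U \<longleftrightarrow> (\<forall>x\<in>U. \<forall>\<^sub>F (x', y) in uniformity. x' = x \<longrightarrow> (y :: ell2) \<in> U)"

lemma seq_zero: "seq 0 i = 0"
  by (simp add: zero_ell2_def seq_Abs_ell2)

lemma seq_add: "seq (x + y) i = seq x i + seq y i"
  by (simp add: plus_ell2_def seq_Abs_ell2 summable_sq_add seq_summable)

lemma seq_uminus: "seq (- x) i = - seq x i"
  by (simp add: uminus_ell2_def seq_Abs_ell2 seq_summable)

lemma seq_diff: "seq (x - y) i = seq x i - seq y i"
proof -
  have "(\<lambda>i. (cmod (seq x i + seq (- y) i))\<^sup>2) summable_on UNIV"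
    by (intro summable_sq_add seq_summable)
  then show ?thesis
    by (simp add: minus_ell2_def seq_uminus seq_Abs_ell2)
qed

lemma seq_scaleR: "seq (r *\<^sub>R x) i = r *\<^sub>R seq x i"
proof -
  have "(\<lambda>i. (cmod (r *\<^sub>R seq x i))\<^sup>2) summable_on UNIV"
    using summable_sq_mult[OF seq_summable, of "of_real r" x] by (simp add: scaleR_conv_of_real)
  then show ?thesis
    by (simp add: scaleR_ell2_def seq_Abs_ell2)
qed

lemma L2_set_le_norm: "finite F \<Longrightarrow> L2_set (\<lambda>i. cmod (seq x i)) F \<le> norm x"
  unfolding norm_ell2_def L2_set_def
  by (intro real_sqrt_le_mono finite_sum_le_infsum seq_summable) auto

lemma norm_ell2_leI:
  assumes "\<And>F. finite F \<Longrightarrow> L2_set (\<lambda>i. cmod (seq x i)) F \<le> b" "0 \<le> b"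
  shows "norm x \<le> b"
proof -
  have "(\<Sum>\<^sub>\<infinity>i. (cmod (seq x i))\<^sup>2) \<le> b\<^sup>2"
  proof (rule infsum_le_finite_sums[OF seq_summable])
    fix F :: "int set" assume "finite F"
    then show "(\<Sum>i\<in>F. (cmod (seq x i))\<^sup>2) \<le> b\<^sup>2"
      using sqrt_le_D[OF assms(1)[of F, unfolded L2_set_def]] by simp
  qed
  then show ?thesis
    using assms(2) unfolding norm_ell2_def by (rule real_le_lsqrt[rotated])
qed

instance
proof
  fix x y z :: ell2 and a b :: real
  show "x + y + z = x + (y + z)" "x + y = y + x" "0 + x = x" "- x + x = 0" "x - y = x + - y"
    by (rule ell2_eqI; simp add: seq_add seq_zero seq_uminus seq_diff)+
  show "a *\<^sub>R (x + y) = a *\<^sub>R x + a *\<^sub>R y" "(a + b) *\<^sub>R x = a *\<^sub>R x + b *\<^sub>R x"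
    "a *\<^sub>R b *\<^sub>R x = (a * b) *\<^sub>R x" "1 *\<^sub>R x = x"
    by (rule ell2_eqI; simp add: seq_add seq_scaleR algebra_simps)+
  show "norm x = 0 \<longleftrightarrow> x = 0"
  proof
    assume "norm x = 0"
    then have "L2_set (\<lambda>i. cmod (seq x i)) {i} \<le> 0" for i
      using L2_set_le_norm[of "{i}" x] by simp
    then show "x = 0"
      by (intro ell2_eqI) (simp add: seq_zero)
  qed (simp add: norm_ell2_def seq_zero)
  have nonneg: "norm u \<ge> 0" for u :: ell2
    by (simp add: norm_ell2_def infsum_nonneg)
  show "norm (x + y) \<le> norm x + norm y"
  proof (rule norm_ell2_leI)
    fix F :: "int set" assume F: "finite F"
    have "L2_set (\<lambda>i. cmod (seq (x + y) i)) F \<le> L2_set (\<lambda>i. cmod (seq x i) + cmod (seq y i)) F"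
      by (rule L2_set_mono) (simp_all add: seq_add norm_triangle_ineq)
    also have "\<dots> \<le> L2_set (\<lambda>i. cmod (seq x i)) F + L2_set (\<lambda>i. cmod (seq y i)) F"
      by (rule L2_set_triangle_ineq)
    also have "\<dots> \<le> norm x + norm y"
      by (intro add_mono L2_set_le_norm F)
    finally show "L2_set (\<lambda>i. cmod (seq (x + y) i)) F \<le> norm x + norm y" .
  qed (simp add: nonneg)
  show "norm (a *\<^sub>R x) = \<bar>a\<bar> * norm x"
    by (simp add: norm_ell2_def seq_scaleR power_mult_distrib infsum_cmult_right' real_sqrt_mult)
qed (rule sgn_ell2_def dist_ell2_def uniformity_ell2_def open_ell2_def)+

end

section \<open>Band matrices and the operators they induce\<close>

type_synonym bimat = "int \<Rightarrow> int \<Rightarrow> complex"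

definition band_matrix :: "bimat \<Rightarrow> bool" where
  "band_matrix A \<longleftrightarrow>
     (\<exists>b. \<forall>i j. A i j \<noteq> 0 \<longrightarrow> \<bar>i - j\<bar> \<le> b) \<and> (\<forall>m. bounded (range (\<lambda>i. A i (i + m))))"

text \<open>The infinite sums have only finitely many nonzero terms when \<open>A\<close> is a band matrix;
  see \<open>mat_op_bounded_linear\<close> for the fact that \<open>mat_op A\<close> then is a bounded operator.\<close>

definition mat_op :: "bimat \<Rightarrow> ell2 \<Rightarrow> ell2" where
  "mat_op A x = Abs_ell2 (\<lambda>i. \<Sum>\<^sub>\<infinity>j. A i j * seq x j)"

text \<open>The Banach space adjoint: transposition without complex conjugation.\<close>

definition adj :: "bimat \<Rightarrow> bimat" where
  "adj A = (\<lambda>i j. A j i)"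

definition minus_scalar :: "bimat \<Rightarrow> complex \<Rightarrow> bimat" where
  "minus_scalar A z = (\<lambda>i j. A i j - (if i = j then z else 0))"

lemma band_matrix_bounds:
  assumes "band_matrix A"
  obtains b :: nat and K :: real
  where "\<And>i j. \<bar>i - j\<bar> > int b \<Longrightarrow> A i j = 0" "\<And>i j. cmod (A i j) \<le> K"
proof -
  obtain b where b: "\<And>i j. A i j \<noteq> 0 \<Longrightarrow> \<bar>i - j\<bar> \<le> b"
    using assms unfolding band_matrix_def by blast
  have "\<forall>m. \<exists>K. \<forall>i. cmod (A i (i + m)) \<le> K"
    using assms unfolding band_matrix_def bounded_iff by auto
  then obtain K where K: "\<And>m i. cmod (A i (i + m)) \<le> K m"
    by metis
  let ?K = "\<Sum>m\<in>{- b..b}. \<bar>K m\<bar>"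
  have "cmod (A i j) \<le> ?K" for i j
  proof (cases "A i j = 0")
    case False
    then have "j - i \<in> {- b..b}"
      using b[of i j] by auto
    then have "\<bar>K (j - i)\<bar> \<le> ?K"
      by (intro member_le_sum) auto
    then show ?thesis
      using K[of i "j - i"] by simp
  qed (simp add: sum_nonneg)
  moreover have "A i j = 0" if "\<bar>i - j\<bar> > int (nat b)" for i j
    using b[of i j] that by linarith
  ultimately show ?thesis
    using that by blast
qed

lemma band_sum:
  fixes A :: bimat
  assumes "\<And>i j. \<bar>i - j\<bar> > int b \<Longrightarrow> A i j = 0"
  shows "(\<Sum>\<^sub>\<infinity>j. A i j * f j) = (\<Sum>m\<in>{- int b..int b}. A i (i + m) * f (i + m))"
proof -
  have "(\<Sum>\<^sub>\<infinity>j. A i j * f j) = (\<Sum>\<^sub>\<infinity>j\<in>{i - int b..i + int b}. A i j * f j)"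
    by (rule infsum_cong_neutral) (auto simp: assms)
  also have "\<dots> = (\<Sum>m\<in>{- int b..int b}. A i (i + m) * f (i + m))"
    by (simp, rule sum.reindex_bij_witness[of _ "\<lambda>m. i + m" "\<lambda>j. j - i"]) auto
  finally show ?thesis .
qed

lemma shift_summable:
  fixes f :: "int \<Rightarrow> real"
  assumes "f summable_on UNIV"
  shows "(\<lambda>i. f (i + m)) summable_on UNIV" "(\<Sum>\<^sub>\<infinity>i. f (i + m)) = infsum f UNIV"
proof -
  have "bij_betw (\<lambda>i. i + m) UNIV (UNIV :: int set)"
    by (rule bij_betw_byWitness[where f' = "\<lambda>i. i - m"]) auto
  then show "(\<lambda>i. f (i + m)) summable_on UNIV" "(\<Sum>\<^sub>\<infinity>i. f (i + m)) = infsum f UNIV"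
    using summable_on_reindex_bij_betw[of _ UNIV UNIV f] infsum_reindex_bij_betw[of _ UNIV UNIV f]
      assms by blast+
qed

lemma has_sum_finite_sum:
  fixes g :: "'b \<Rightarrow> int \<Rightarrow> real"
  assumes "finite M" "\<And>m. m \<in> M \<Longrightarrow> g m summable_on UNIV"
  shows "((\<lambda>i. \<Sum>m\<in>M. g m i) has_sum (\<Sum>m\<in>M. infsum (g m) UNIV)) UNIV"
  using assms
proof (induction M rule: finite_induct)
  case (insert m M)
  then have "((\<lambda>i. g m i + (\<Sum>m\<in>M. g m i)) has_sum (infsum (g m) UNIV + (\<Sum>m\<in>M. infsum (g m) UNIV))) UNIV"
    by (intro has_sum_add has_sum_infsum) auto
  then show ?case
    using insert.hyps by simp
qed simp

lemma band_op_bound: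
  fixes A :: bimat
  assumes "\<And>i j. \<bar>i - j\<bar> > int b \<Longrightarrow> A i j = 0" "\<And>i j. cmod (A i j) \<le> K"
  shows "(\<lambda>i. (cmod (\<Sum>\<^sub>\<infinity>j. A i j * seq x j))\<^sup>2) summable_on UNIV"
    and "(\<Sum>\<^sub>\<infinity>i. (cmod (\<Sum>\<^sub>\<infinity>j. A i j * seq x j))\<^sup>2) \<le> ((2 * real b + 1) * K * norm x)\<^sup>2"
proof -
  let ?M = "{- int b..int b}"
  let ?g = "\<lambda>i. \<Sum>m\<in>?M. (2 * real b + 1) * K\<^sup>2 * (cmod (seq x (i + m)))\<^sup>2"
  have card: "real (card ?M) = 2 * real b + 1"
    by simp
  have le: "(cmod (\<Sum>\<^sub>\<infinity>j. A i j * seq x j))\<^sup>2 \<le> ?g i" for i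
  proof -
    have "cmod (\<Sum>\<^sub>\<infinity>j. A i j * seq x j) \<le> (\<Sum>m\<in>?M. cmod (A i (i + m) * seq x (i + m)))"
      using assms(1) by (simp only: band_sum[of b A] norm_sum)
    also have "\<dots> \<le> (\<Sum>m\<in>?M. K * cmod (seq x (i + m)))"
      by (intro sum_mono) (simp add: norm_mult mult_right_mono assms(2))
    finally have "(cmod (\<Sum>\<^sub>\<infinity>j. A i j * seq x j))\<^sup>2 \<le> (\<Sum>m\<in>?M. K * cmod (seq x (i + m)))\<^sup>2"
      by (intro power_mono) auto
    also have "\<dots> \<le> (\<Sum>m\<in>?M. (K * cmod (seq x (i + m)))\<^sup>2) * real (card ?M)"
      by (rule sum_squared_le_sum_of_squares) 
    also have "\<dots> = ?g i"
      unfolding card by (simp add: sum_distrib_left sum_distrib_right power_mult_distrib mult_ac)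
    finally show ?thesis .
  qed
  have gs: "(\<lambda>i. (2 * real b + 1) * K\<^sup>2 * (cmod (seq x (i + m)))\<^sup>2) summable_on UNIV" for m
    by (intro summable_on_cmult_right shift_summable(1)[of "\<lambda>i. (cmod (seq x i))\<^sup>2"] seq_summable)
  have g: "?g summable_on UNIV"
    by (rule has_sum_imp_summable, rule has_sum_finite_sum) (use gs in auto)
  show s: "(\<lambda>i. (cmod (\<Sum>\<^sub>\<infinity>j. A i j * seq x j))\<^sup>2) summable_on UNIV"
    by (rule summable_on_comparison_test[OF g]) (use le in auto)
  have nx: "(\<Sum>\<^sub>\<infinity>i. (cmod (seq x i))\<^sup>2) = (norm x)\<^sup>2"
    by (simp add: norm_ell2_def infsum_nonneg)
  have "(\<Sum>\<^sub>\<infinity>i. (cmod (\<Sum>\<^sub>\<infinity>j. A i j * seq x j))\<^sup>2) \<le> infsum ?g UNIV"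
    by (rule infsum_mono[OF s g]) (use le in auto)
  also have "\<dots> = (\<Sum>m\<in>?M. \<Sum>\<^sub>\<infinity>i. (2 * real b + 1) * K\<^sup>2 * (cmod (seq x (i + m)))\<^sup>2)"
    by (rule infsumI, rule has_sum_finite_sum) (use gs in auto)
  also have "\<dots> = (\<Sum>m\<in>?M. (2 * real b + 1) * K\<^sup>2 * (norm x)\<^sup>2)"
    by (simp add: infsum_cmult_right' shift_summable(2)[of "\<lambda>i. (cmod (seq x i))\<^sup>2"] seq_summable nx
        del: sum_constant)
  also have "\<dots> = ((2 * real b + 1) * K * norm x)\<^sup>2"
    unfolding sum_constant card by (simp add: power2_eq_square)
  finally show "(\<Sum>\<^sub>\<infinity>i. (cmod (\<Sum>\<^sub>\<infinity>j. A i j * seq x j))\<^sup>2) \<le> ((2 * real b + 1) * K * norm x)\<^sup>2" .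
qed

lemma seq_mat_op:
  assumes "band_matrix A"
  shows "seq (mat_op A x) i = (\<Sum>\<^sub>\<infinity>j. A i j * seq x j)"
proof -
  obtain b :: nat and K :: real
    where "\<And>i j. \<bar>i - j\<bar> > int b \<Longrightarrow> A i j = 0" "\<And>i j. cmod (A i j) \<le> K"
    using band_matrix_bounds[OF assms] by metis
  then show ?thesis
    unfolding mat_op_def by (subst seq_Abs_ell2) (auto intro!: band_op_bound(1))
qed

lemma mat_op_bounded_linear:
  assumes "band_matrix A"
  shows "bounded_linear (mat_op A)"
proof -
  obtain b :: nat and K :: real
    where bK: "\<And>i j. \<bar>i - j\<bar> > int b \<Longrightarrow> A i j = 0" "\<And>i j. cmod (A i j) \<le> K"
    using band_matrix_bounds[OF assms] by metis
  have K: "K \<ge> 0"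
    using bK(2)[of 0 0] norm_ge_zero[of "A 0 0"] by linarith
  have e: "seq (mat_op A x) i = (\<Sum>m\<in>{- int b..int b}. A i (i + m) * seq x (i + m))" for x i
    using seq_mat_op[OF assms] band_sum[of b A] bK(1) by simp
  show ?thesis
  proof (rule bounded_linear_intro[where K = "(2 * real b + 1) * K"])
    fix x y :: ell2 and r :: real
    show "mat_op A (x + y) = mat_op A x + mat_op A y"
      by (rule ell2_eqI) (simp add: e seq_add algebra_simps sum.distrib)
    show "mat_op A (r *\<^sub>R x) = r *\<^sub>R mat_op A x"
      by (rule ell2_eqI) (simp add: e seq_scaleR scaleR_sum_right)
    have "norm (mat_op A x) = sqrt (\<Sum>\<^sub>\<infinity>i. (cmod (\<Sum>\<^sub>\<infinity>j. A i j * seq x j))\<^sup>2)"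
      by (simp add: norm_ell2_def seq_mat_op[OF assms])
    also have "\<dots> \<le> (2 * real b + 1) * K * norm x"
      using bK K by (intro real_le_lsqrt band_op_bound(2)) auto
    finally show "norm (mat_op A x) \<le> norm x * ((2 * real b + 1) * K)"
      by (simp add: mult.commute)
  qed
qed

section \<open>Block-tridiagonal representation\<close>

text \<open>The set below is finite for a band matrix; for the zero matrix it is empty, and
  \<open>Sup {} = 0\<close> on the natural numbers.\<close>

definition bandwidth :: "bimat \<Rightarrow> nat" where
  "bandwidth A = Sup {nat \<bar>i - j\<bar> | i j. A i j \<noteq> 0}"

definition block_size :: "bimat \<Rightarrow> nat" where
  "block_size A = (if bandwidth A \<le> 1 then 1 else bandwidth A + 1)"

text \<open>Throughout, \<open>c\<close> is the scalar index at which block \<open>0\<close> starts and \<open>d\<close> is the block length, so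
  block \<open>i\<close> consists of the scalar indices \<open>c + d i, \<dots>, c + d i + d - 1\<close>. A sequence \<open>x\<close> is
  identified with the sequence of vectors \<open>(x (c + d i + r))\<close>, \<open>r < d\<close>, which is an isometry; hence
  no separate space of vector-valued sequences is introduced.\<close>

definition block_entry :: "bimat \<Rightarrow> int \<Rightarrow> nat \<Rightarrow> int \<Rightarrow> int \<Rightarrow> nat \<Rightarrow> nat \<Rightarrow> complex" where
  "block_entry A c d i j = (\<lambda>r s. A (c + int d * i + int r) (c + int d * j + int s))"

text \<open>Operator norm of a \<open>d \<times> d\<close> matrix with respect to the Euclidean norm.\<close>

definition matrix_norm :: "nat \<Rightarrow> (nat \<Rightarrow> nat \<Rightarrow> complex) \<Rightarrow> real" where
  "matrix_norm d M =
     (SUP v\<in>{v :: nat \<Rightarrow> complex. L2_set (\<lambda>s. cmod (v s)) {..<d} \<le> 1}.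
        L2_set (\<lambda>r. cmod (\<Sum>s<d. M r s * v s)) {..<d})"

definition alpha_norm :: "bimat \<Rightarrow> int \<Rightarrow> real" where
  "alpha_norm A c = (SUP i. matrix_norm (block_size A) (block_entry A c (block_size A) (i + 1) i))"

definition gamma_norm :: "bimat \<Rightarrow> int \<Rightarrow> real" where
  "gamma_norm A c = (SUP i. matrix_norm (block_size A) (block_entry A c (block_size A) (i - 1) i))"

definition eps_seq :: "bimat \<Rightarrow> int \<Rightarrow> nat \<Rightarrow> real" where
  "eps_seq A c n = 2 * (alpha_norm A c + gamma_norm A c) * sin (pi / (2 * (real n + 1)))"

text \<open>Sequences supported in the blocks \<open>k + 1, \<dots>, k + n\<close>; the scalar index \<open>j\<close> lies in block
  \<open>(j - c) div d\<close>.\<close>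

definition block_supported :: "int \<Rightarrow> nat \<Rightarrow> nat \<Rightarrow> int \<Rightarrow> ell2 set" where
  "block_supported c d n k = {x. \<forall>j. seq x j \<noteq> 0 \<longrightarrow> (j - c) div int d \<in> {k + 1..k + int n}}"

section \<open>Pseudospectra\<close>

definition lower_norm_on :: "ell2 set \<Rightarrow> (ell2 \<Rightarrow> ell2) \<Rightarrow> real" where
  "lower_norm_on V T = (INF x\<in>{x \<in> V. norm x = 1}. norm (T x))"

text \<open>Linearity here is over the reals, but the inverse of a complex-linear bijection is
  complex-linear.\<close>

definition inverse_norm :: "(ell2 \<Rightarrow> ell2) \<Rightarrow> ereal" where
  "inverse_norm T = (if bij T \<and> bounded_linear (inv T) then ereal (onorm (inv T)) else \<infinity>)"

definition pspec :: "real \<Rightarrow> bimat \<Rightarrow> complex set" where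
  "pspec \<epsilon> A = {z. inverse_norm (mat_op (minus_scalar A z)) > ereal (1 / \<epsilon>)}"

definition pspec_cols :: "real \<Rightarrow> bimat \<Rightarrow> int \<Rightarrow> nat \<Rightarrow> nat \<Rightarrow> int \<Rightarrow> complex set" where
  "pspec_cols \<epsilon> B c d n k =
     {z. lower_norm_on (block_supported c d n k) (mat_op (minus_scalar B z)) < \<epsilon>}"

definition pspec_cols2 :: "real \<Rightarrow> bimat \<Rightarrow> int \<Rightarrow> nat \<Rightarrow> int \<Rightarrow> complex set" where
  "pspec_cols2 \<epsilon> A c n k =
     pspec_cols \<epsilon> A c (block_size A) n k \<union> pspec_cols \<epsilon> (adj A) c (block_size A) n k"

section \<open>Hausdorff convergence\<close>

definition hausdorff_distance :: "complex set \<Rightarrow> complex set \<Rightarrow> real" where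
  "hausdorff_distance S T = max (SUP s\<in>S. infdist s T) (SUP t\<in>T. infdist t S)"

text \<open>The distance is meaningful for nonempty bounded sets only, so these conditions are part of
  the notion of convergence.\<close>

definition hausdorff_converges :: "(nat \<Rightarrow> complex set) \<Rightarrow> complex set \<Rightarrow> bool" where
  "hausdorff_converges S T \<longleftrightarrow>
     T \<noteq> {} \<and> bounded T \<and> (\<forall>\<^sub>F n in sequentially. S n \<noteq> {} \<and> bounded (S n)) \<and>
     (\<lambda>n. hausdorff_distance (S n) T) \<longlonglongrightarrow> 0"

end

theory Submission
  imports Defs "HOL-Complex_Analysis.Conformal_Mappings"
begin

text \<open>
  A point \<open>z\<close> lies in \<open>pspec \<epsilon> A\<close> iff \<open>A - z\<close> or its adjoint maps some vector \<open>x\<close> to a vector of norm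
  less than \<open>\<epsilon> \<parallel>x\<parallel>\<close> (\<open>in_pspec_iff\<close>). The column sets are defined by the same condition with \<open>x\<close>
  restricted to a window of \<open>n\<close> blocks, so they are contained in the pseudospectrum of the same level.

  Conversely, any such \<open>x\<close> can be localised to a window at the price of raising the level by
  \<open>eps_seq A c n\<close> (\<open>localisation_to_window\<close>). Multiply \<open>x\<close> by the weights \<open>sin (m pi / (n + 1))\<close> placed on
  a window, and average over all positions of the window. The commutator of \<open>A\<close> with the weights sees
  only the off-diagonal blocks and the differences of neighbouring weights. For the sine weights,
  which form the lowest eigenvector of the discrete Dirichlet Laplacian, the ratio of the
  sums of squared differences and of squared weights is exactly \<open>(2 sin (pi / (2 (n + 1))))\<^sup>2\<close>. Hence
  \<open>pspec \<delta> A\<close> is contained in the union of the column sets of level \<open>\<delta> + eps_seq A c n\<close>, for every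
  \<open>\<delta> > 0\<close>.

  With \<open>\<delta> = \<epsilon>\<close> and \<open>\<delta> = \<epsilon> - eps_seq A c n\<close> both unions are squeezed between pseudospectra whose levels
  tend to \<open>\<epsilon>\<close>. So everything reduces to the continuity of \<open>\<delta> \<mapsto> pspec \<delta> A\<close> in the Hausdorff distance
  (\<open>pspec_eventually_near\<close>). It would fail if the resolvent norm were equal to \<open>1 / \<epsilon>\<close> on
  an open set, which a Hilbert space excludes: if the resolvent is bounded by \<open>1 / \<delta>\<close> on a disc of radius above \<open>r\<close>
  around \<open>z\<close>, then at \<open>z\<close> it is bounded by \<open>1 / (\<delta> sqrt (1 + r\<^sup>2 / C\<^sup>2))\<close>, where \<open>C\<close> bounds \<open>A - z\<close>
  (\<open>lower_bound_gain\<close>). The same estimate on discs of arbitrary radius shows that pseudospectra are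
  not empty.
\<close>

section \<open>The bilinear pairing on the sequence space\<close>

definition cscale :: "complex \<Rightarrow> ell2 \<Rightarrow> ell2" where
  "cscale a x = Abs_ell2 (\<lambda>i. a * seq x i)"

definition conj_seq :: "ell2 \<Rightarrow> ell2" where
  "conj_seq x = Abs_ell2 (\<lambda>i. cnj (seq x i))"

text \<open>The pairing is bilinear, without conjugation: with respect to it the adjoint of a matrix operator is
  given by the plain transpose. The inner product of \<open>x\<close> and \<open>y\<close> is \<open>pairing x (conj_seq y)\<close>.\<close>

definition pairing :: "ell2 \<Rightarrow> ell2 \<Rightarrow> complex" where
  "pairing x y = (\<Sum>\<^sub>\<infinity>i. seq x i * seq y i)"

lemma seq_cscale [simp]: "seq (cscale a x) i = a * seq x i"
  unfolding cscale_def by (subst seq_Abs_ell2) (auto intro: summable_sq_mult seq_summable)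

lemma seq_conj_seq [simp]: "seq (conj_seq x) i = cnj (seq x i)"
  unfolding conj_seq_def by (subst seq_Abs_ell2) (auto simp: seq_summable)

lemma norm_sq_ell2: "(norm x)\<^sup>2 = (\<Sum>\<^sub>\<infinity>i. (cmod (seq x i))\<^sup>2)"
  by (simp add: norm_ell2_def infsum_nonneg)

lemma norm_sq_has_sum: "((\<lambda>i. (cmod (seq x i))\<^sup>2) has_sum (norm x)\<^sup>2) UNIV"
  unfolding norm_sq_ell2 by (rule has_sum_infsum[OF seq_summable])

lemma norm_cscale [simp]: "norm (cscale a x) = cmod a * norm x"
  by (simp add: norm_ell2_def norm_mult power_mult_distrib infsum_cmult_right' real_sqrt_mult)

lemma norm_conj_seq [simp]: "norm (conj_seq x) = norm x"
  by (simp add: norm_ell2_def)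

lemma conj_seq_conj_seq [simp]: "conj_seq (conj_seq x) = x"
  by (rule ell2_eqI) simp

lemma cscale_of_real: "cscale (of_real r) x = r *\<^sub>R x"
  by (rule ell2_eqI) (simp add: seq_scaleR scaleR_conv_of_real)

lemma conj_seq_add: "conj_seq (x + y) = conj_seq x + conj_seq y"
  by (rule ell2_eqI) (simp add: seq_add)

lemma conj_seq_cscale: "conj_seq (cscale a x) = cscale (cnj a) (conj_seq x)"
  by (rule ell2_eqI) simp

lemma pairing_abs_summable: "(\<lambda>i. cmod (seq x i * seq y i)) summable_on UNIV"
proof (rule Infinite_Sum.abs_summable_on_comparison_test')
  show "(\<lambda>i. (cmod (seq x i))\<^sup>2 + (cmod (seq y i))\<^sup>2) summable_on UNIV"
    by (intro summable_on_add seq_summable)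
  fix i
  have "2 * (cmod (seq x i) * cmod (seq y i)) \<le> (cmod (seq x i))\<^sup>2 + (cmod (seq y i))\<^sup>2"
    using sum_squares_bound[of "cmod (seq x i)" "cmod (seq y i)"] by simp
  moreover have "0 \<le> cmod (seq x i) * cmod (seq y i)" by simp
  ultimately show "cmod (seq x i * seq y i) \<le> (cmod (seq x i))\<^sup>2 + (cmod (seq y i))\<^sup>2"
    unfolding norm_mult by linarith
qed

lemma pairing_summable: "(\<lambda>i. seq x i * seq y i) summable_on UNIV"
  using abs_summable_summable[OF pairing_abs_summable] .

lemma norm_pairing_le: "cmod (pairing x y) \<le> norm x * norm y"
proof -
  have "cmod (pairing x y) \<le> (\<Sum>\<^sub>\<infinity>i. cmod (seq x i * seq y i))"
    unfolding pairing_def by (rule norm_infsum_bound[OF pairing_abs_summable])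
  also have "\<dots> \<le> norm x * norm y"
  proof (rule infsum_le_finite_sums[OF pairing_abs_summable])
    fix F :: "int set" assume F: "finite F"
    have "(\<Sum>i\<in>F. cmod (seq x i * seq y i))
        \<le> L2_set (\<lambda>i. cmod (seq x i)) F * L2_set (\<lambda>i. cmod (seq y i)) F"
      using L2_set_mult_ineq[of "\<lambda>i. cmod (seq x i)" "\<lambda>i. cmod (seq y i)" F]
      by (simp add: norm_mult)
    also have "\<dots> \<le> norm x * norm y"
      by (intro mult_mono L2_set_le_norm F) auto
    finally show "(\<Sum>i\<in>F. cmod (seq x i * seq y i)) \<le> norm x * norm y" .
  qed
  finally show ?thesis .
qed

lemma pairing_commute: "pairing x y = pairing y x"
  by (simp add: pairing_def mult.commute)

lemma pairing_add_left: "pairing (x + y) z = pairing x z + pairing y z"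
  unfolding pairing_def seq_add distrib_right by (intro infsum_add pairing_summable)

lemma pairing_diff_left: "pairing (x - y) z = pairing x z - pairing y z"
  using pairing_add_left[of "x - y" y z] by simp

lemma pairing_cscale_left: "pairing (cscale a x) z = a * pairing x z"
  by (simp add: pairing_def mult.assoc infsum_cmult_right')

lemma pairing_add_right: "pairing x (y + z) = pairing x y + pairing x z"
  by (metis pairing_add_left pairing_commute)

lemma pairing_cscale_right: "pairing x (cscale a z) = a * pairing x z"
  by (metis pairing_cscale_left pairing_commute)

lemma pairing_conj_self: "pairing x (conj_seq x) = of_real ((norm x)\<^sup>2)"
  unfolding pairing_def seq_conj_seq complex_norm_square[symmetric]
  by (rule infsumI) (rule has_sum_of_real[OF norm_sq_has_sum])

lemma pairing_conj_swap: "pairing y (conj_seq x) = cnj (pairing x (conj_seq y))"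
  by (simp add: pairing_def mult.commute flip: infsum_cnj)

lemma norm_sq_add:
  "(norm (x + y))\<^sup>2 = (norm x)\<^sup>2 + 2 * Re (pairing x (conj_seq y)) + (norm y)\<^sup>2"
proof -
  have "of_real ((norm (x + y))\<^sup>2) =
     of_real ((norm x)\<^sup>2) + (pairing x (conj_seq y) + cnj (pairing x (conj_seq y))) + complex_of_real ((norm y)\<^sup>2)"
    unfolding pairing_conj_self[symmetric] pairing_conj_swap[of y x, symmetric] conj_seq_add
      pairing_add_left pairing_add_right by simp
  from arg_cong[OF this, of Re] show ?thesis by simp
qed

text \<open>Completeness is what turns a lower bound on the adjoint into surjectivity. A Cauchy sequence converges
  coordinatewise, and the bounds on finite partial sums, being uniform, pass to the limit.\<close>

instance ell2 :: banach
proof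
  fix X :: "nat \<Rightarrow> ell2"
  assume X: "Cauchy X"
  have L2_diff: "L2_set (\<lambda>i. cmod (seq (X m) i - seq (X n) i)) F \<le> norm (X m - X n)"
    if "finite F" for m n F
    using L2_set_le_norm[OF that, of "X m - X n"] by (simp add: seq_diff)
  have "Cauchy (\<lambda>n. seq (X n) i)" for i
  proof (rule metric_CauchyI)
    fix e :: real assume "e > 0"
    then obtain N where N: "\<And>m n. m \<ge> N \<Longrightarrow> n \<ge> N \<Longrightarrow> dist (X m) (X n) < e"
      using metric_CauchyD[OF X \<open>e > 0\<close>] by blast
    have "dist (seq (X m) i) (seq (X n) i) < e" if "m \<ge> N" "n \<ge> N" for m n
      using N[OF that] L2_diff[of "{i}" m n] by (simp add: dist_norm)
    then show "\<exists>M. \<forall>m\<ge>M. \<forall>n\<ge>M. dist (seq (X m) i) (seq (X n) i) < e" by blast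
  qed
  then have "\<exists>l. (\<lambda>n. seq (X n) i) \<longlonglongrightarrow> l" for i
    unfolding Cauchy_convergent_iff convergent_def .
  then obtain l where l: "\<And>i. (\<lambda>n. seq (X n) i) \<longlonglongrightarrow> l i"
    by metis
  have bound: "\<exists>N. \<forall>m\<ge>N. \<forall>F. finite F \<longrightarrow> L2_set (\<lambda>i. cmod (seq (X m) i - l i)) F \<le> e"
    if "e > 0" for e
  proof -
    obtain N where N: "\<And>m n. m \<ge> N \<Longrightarrow> n \<ge> N \<Longrightarrow> dist (X m) (X n) < e"
      using metric_CauchyD[OF X \<open>e > 0\<close>] by blast
    have "L2_set (\<lambda>i. cmod (seq (X m) i - l i)) F \<le> e" if "m \<ge> N" "finite F" for m F
    proof (rule tendsto_upperbound)
      show "(\<lambda>n. L2_set (\<lambda>i. cmod (seq (X m) i - seq (X n) i)) F)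
          \<longlonglongrightarrow> L2_set (\<lambda>i. cmod (seq (X m) i - l i)) F"
        unfolding L2_set_def by (intro tendsto_intros l)
      show "\<forall>\<^sub>F n in sequentially. L2_set (\<lambda>i. cmod (seq (X m) i - seq (X n) i)) F \<le> e"
      proof (rule eventually_sequentiallyI[of N])
        fix n assume "N \<le> n"
        then show "L2_set (\<lambda>i. cmod (seq (X m) i - seq (X n) i)) F \<le> e"
          using N[of m n] L2_diff[of F m n] that by (simp add: dist_norm)
      qed
    qed simp
    then show ?thesis by blast
  qed
  obtain N where N: "\<And>F. finite F \<Longrightarrow> L2_set (\<lambda>i. cmod (seq (X N) i - l i)) F \<le> 1"
    using bound[of 1] by auto
  have "(\<lambda>i. (cmod (seq (X N) i - l i))\<^sup>2) summable_on UNIV"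
  proof (rule nonneg_bdd_above_summable_on)
    show "bdd_above (sum (\<lambda>i. (cmod (seq (X N) i - l i))\<^sup>2) ` {F. F \<subseteq> UNIV \<and> finite F})"
      using N by (intro bdd_aboveI2[of _ _ 1]) (auto simp: L2_set_def)
  qed simp
  then have "(\<lambda>i. (cmod (seq (X N) i + - 1 * (seq (X N) i - l i)))\<^sup>2) summable_on UNIV"
    by (intro summable_sq_add summable_sq_mult seq_summable)
  then have sl: "seq (Abs_ell2 l) = l"
    by (intro seq_Abs_ell2) simp
  have "X \<longlonglongrightarrow> Abs_ell2 l"
  proof (rule metric_LIMSEQ_I)
    fix e :: real assume e: "e > 0"
    then obtain N where N: "\<And>m F. m \<ge> N \<Longrightarrow> finite F \<Longrightarrow> L2_set (\<lambda>i. cmod (seq (X m) i - l i)) F \<le> e / 2"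
      using bound[of "e / 2"] by auto
    have "dist (X m) (Abs_ell2 l) \<le> e / 2" if "m \<ge> N" for m
      unfolding dist_norm by (rule norm_ell2_leI) (use N[OF that] e in \<open>auto simp: seq_diff sl\<close>)
    then show "\<exists>N. \<forall>m\<ge>N. dist (X m) (Abs_ell2 l) < e"
      using e by (intro exI[of _ N]) force
  qed
  then show "convergent X" by (rule convergentI)
qed

section \<open>Adjoints, lower bounds and invertibility\<close>

lemma band_matrix_adj [simp]:
  assumes "band_matrix A"
  shows "band_matrix (adj A)"
proof -
  have "range (\<lambda>i. A (i + m) i) \<subseteq> range (\<lambda>i. A i (i + - m))" for m
    by (force intro: image_eqI[of _ _ "_ + m"])
  then show ?thesis
    using assms unfolding band_matrix_def adj_def
    by (metis abs_minus_commute bounded_subset)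
qed

lemma band_matrix_minus_scalar [simp]:
  assumes "band_matrix A"
  shows "band_matrix (minus_scalar A z)"
proof -
  obtain b where b: "\<And>i j. A i j \<noteq> 0 \<Longrightarrow> \<bar>i - j\<bar> \<le> b"
    using assms unfolding band_matrix_def by blast
  have "\<bar>i - j\<bar> \<le> \<bar>b\<bar>" if "minus_scalar A z i j \<noteq> 0" for i j
    using that b[of i j] by (cases "i = j") (auto simp: minus_scalar_def)
  moreover have "bounded (range (\<lambda>i. minus_scalar A z i (i + m)))" for m
    using assms unfolding band_matrix_def minus_scalar_def
    by (intro bounded_minus_comp) (auto simp: bounded_iff)
  ultimately show ?thesis
    unfolding band_matrix_def by blast
qed

lemma adj_minus_scalar: "adj (minus_scalar A z) = minus_scalar (adj A) z"
  by (auto simp: adj_def minus_scalar_def fun_eq_iff)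

lemma seq_mat_op_finite_sum:
  assumes "band_matrix A" "\<And>i j. \<bar>i - j\<bar> > int b \<Longrightarrow> A i j = 0"
  shows "seq (mat_op A x) i = (\<Sum>m\<in>{- int b..int b}. A i (i + m) * seq x (i + m))"
  using seq_mat_op[OF assms(1)] band_sum[of b A] assms(2) by simp

lemma linear_mat_op: "band_matrix A \<Longrightarrow> linear (mat_op A)"
  by (rule bounded_linear.linear[OF mat_op_bounded_linear])

lemma mat_op_diff: "band_matrix A \<Longrightarrow> mat_op A (x - y) = mat_op A x - mat_op A y"
  by (rule linear_diff[OF linear_mat_op])

lemma mat_op_cscale:
  assumes "band_matrix A"
  shows "mat_op A (cscale a x) = cscale a (mat_op A x)"
  by (rule ell2_eqI) (simp add: seq_mat_op assms mult.left_commute infsum_cmult_right')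

lemma mat_op_minus_scalar:
  assumes "band_matrix A"
  shows "mat_op (minus_scalar A z) x = mat_op A x - cscale z x"
proof (rule ell2_eqI)
  fix i
  obtain b :: nat and K :: real where b: "\<And>i j. \<bar>i - j\<bar> > int b \<Longrightarrow> A i j = 0"
    using band_matrix_bounds[OF assms] by metis
  have "(\<Sum>m\<in>{- int b..int b}. (if m = 0 then z else 0) * seq x (i + m))
      = (\<Sum>m\<in>{- int b..int b}. if m = 0 then z * seq x i else 0)"
    by (intro sum.cong) auto
  then show "seq (mat_op (minus_scalar A z) x) i = seq (mat_op A x - cscale z x) i"
    using b assms
    by (subst seq_mat_op_finite_sum[OF band_matrix_minus_scalar, of A b])
      (auto simp: minus_scalar_def seq_diff seq_mat_op_finite_sum[of A b] left_diff_distrib sum_subtractf)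
qed

lemma has_sum_sum_finite:
  fixes f :: "'a \<Rightarrow> 'b \<Rightarrow> 'c :: topological_comm_monoid_add"
  assumes "finite M" "\<And>m. m \<in> M \<Longrightarrow> (f m has_sum s m) S"
  shows "((\<lambda>i. \<Sum>m\<in>M. f m i) has_sum (\<Sum>m\<in>M. s m)) S"
  using assms by (induction M rule: finite_induct) (auto intro: has_sum_add)

text \<open>Both sides are the same double sum over the finitely many diagonals of \<open>A\<close>; on each diagonal the
  index is shifted by the number of that diagonal.\<close>

lemma pairing_mat_op:
  assumes "band_matrix A"
  shows "pairing (mat_op A x) y = pairing x (mat_op (adj A) y)"
proof -
  obtain b :: nat and K :: real
    where b: "\<And>i j. \<bar>i - j\<bar> > int b \<Longrightarrow> A i j = 0" and K: "\<And>i j. cmod (A i j) \<le> K"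
    using band_matrix_bounds[OF assms] by metis
  let ?M = "{- int b..int b}"
  define f where "f m i = A i (i + m) * seq x (i + m) * seq y i" for m i
  have shift: "bij_betw (\<lambda>i::int. i - m) UNIV UNIV" for m
    by (rule bij_betw_byWitness[where f' = "\<lambda>i. i + m"]) auto
  have f: "f m summable_on UNIV" for m
  proof (rule abs_summable_summable, rule Infinite_Sum.abs_summable_on_comparison_test')
    show "(\<lambda>i. K * ((cmod (seq x (i + m)))\<^sup>2 + (cmod (seq y i))\<^sup>2)) summable_on UNIV"
      by (intro summable_on_cmult_right summable_on_add seq_summable
          shift_summable(1)[of "\<lambda>i. (cmod (seq x i))\<^sup>2"])
    fix i
    have "2 * (cmod (seq x (i + m)) * cmod (seq y i)) \<le> (cmod (seq x (i + m)))\<^sup>2 + (cmod (seq y i))\<^sup>2"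
      using sum_squares_bound[of "cmod (seq x (i + m))" "cmod (seq y i)"] by simp
    moreover have "0 \<le> cmod (seq x (i + m)) * cmod (seq y i)" by simp
    ultimately have "cmod (seq x (i + m)) * cmod (seq y i) \<le> (cmod (seq x (i + m)))\<^sup>2 + (cmod (seq y i))\<^sup>2"
      by linarith
    then show "norm (f m i) \<le> K * ((cmod (seq x (i + m)))\<^sup>2 + (cmod (seq y i))\<^sup>2)"
      unfolding f_def norm_mult mult.assoc
      by (intro mult_mono K order_trans[OF norm_ge_zero K]) auto
  qed
  have "(f m has_sum infsum (f m) UNIV) UNIV" for m
    by (rule has_sum_infsum[OF f])
  then have h1: "((\<lambda>i. \<Sum>m\<in>?M. f m i) has_sum (\<Sum>m\<in>?M. infsum (f m) UNIV)) UNIV"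
    by (intro has_sum_sum_finite) auto
  have h2: "((\<lambda>i. \<Sum>m\<in>?M. f m (i - m)) has_sum (\<Sum>m\<in>?M. infsum (f m) UNIV)) UNIV"
  proof (rule has_sum_sum_finite)
    fix m
    show "((\<lambda>i. f m (i - m)) has_sum infsum (f m) UNIV) UNIV"
      by (subst has_sum_reindex_bij_betw[OF shift, of "f m"]) (rule has_sum_infsum[OF f])
  qed simp
  have e1: "(\<Sum>m\<in>?M. f m i) = seq (mat_op A x) i * seq y i" for i
    by (simp add: f_def seq_mat_op_finite_sum[OF assms b] sum_distrib_right)
  have e2: "(\<Sum>m\<in>?M. f m (i - m)) = seq x i * seq (mat_op (adj A) y) i" for i
  proof -
    have "(\<Sum>m\<in>?M. f m (i - m)) = (\<Sum>m\<in>?M. f (- m) (i + m))"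
      by (rule sum.reindex_bij_witness[of _ uminus uminus]) auto
    also have "\<dots> = seq x i * seq (mat_op (adj A) y) i"
      by (subst seq_mat_op_finite_sum[OF band_matrix_adj[OF assms], of b])
        (auto simp: f_def adj_def b sum_distrib_left mult_ac)
    finally show ?thesis .
  qed
  show ?thesis
    unfolding pairing_def infsumI[OF h1[unfolded e1]] infsumI[OF h2[unfolded e2]] ..
qed

text \<open>Let \<open>H\<close> be the conjugate transpose of \<open>B\<close>. It inherits the lower bound from \<open>adj B\<close>, so
  \<open>T = B H\<close> satisfies \<open>\<langle>T x, x\<rangle> = \<parallel>H x\<parallel>\<^sup>2 \<ge> e\<^sup>2 \<parallel>x\<parallel>\<^sup>2\<close>. As in the Lax-Milgram lemma, \<open>x \<mapsto> x - t (T x - y)\<close> is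
  then a contraction for small \<open>t > 0\<close>, and its fixed point solves \<open>B (H x) = y\<close>.\<close>

lemma mat_op_surj_if_adj_bounded_below:
  assumes B: "band_matrix B" and "e > 0" and low: "\<And>y. e * norm y \<le> norm (mat_op (adj B) y)"
  shows "surj (mat_op B)"
  unfolding surj_def
proof
  fix y
  define H where "H x = conj_seq (mat_op (adj B) (conj_seq x))" for x
  define T where "T x = mat_op B (H x)" for x
  note bl = mat_op_bounded_linear[OF B] mat_op_bounded_linear[OF band_matrix_adj[OF B]]
  obtain K where K: "\<And>x. norm (mat_op B x) \<le> norm x * K" "K > 0"
    using bounded_linear.pos_bounded[OF bl(1)] by metis
  obtain L where L: "\<And>x. norm (mat_op (adj B) x) \<le> norm x * L" "L > 0"
    using bounded_linear.pos_bounded[OF bl(2)] by metis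
  \<comment> \<open>The summand \<open>e\<^sup>2\<close> ensures \<open>e\<^sup>2 \<le> C\<close>, so that \<open>q\<close> below is nonnegative.\<close>
  define C where "C = L * K + e\<^sup>2"
  have C: "C > 0" "e\<^sup>2 \<le> C"
    using K L \<open>e > 0\<close> by (auto simp: C_def add_pos_pos)
  have T_bound: "norm (T x) \<le> C * norm x" for x
  proof -
    have "norm (T x) \<le> norm (H x) * K" by (simp add: T_def K)
    also have "\<dots> \<le> norm x * L * K"
      using L(1)[of "conj_seq x"] K by (intro mult_right_mono) (auto simp: H_def)
    also have "\<dots> \<le> C * norm x"
      by (simp add: C_def algebra_simps)
    finally show ?thesis .
  qed
  have T_diff: "T (x - x') = T x - T x'" for x x'
  proof -
    have "conj_seq (u - v) = conj_seq u - conj_seq v" for u v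
      by (rule ell2_eqI) (simp add: seq_diff)
    then show ?thesis
      by (simp add: T_def H_def mat_op_diff B)
  qed
  have T_pos: "Re (pairing x (conj_seq (T x))) = (norm (H x))\<^sup>2" for x
  proof -
    have "pairing (T x) (conj_seq x) = of_real ((norm (H x))\<^sup>2)"
      unfolding T_def pairing_mat_op[OF B] pairing_conj_self[symmetric] by (simp add: H_def)
    then show ?thesis
      by (subst pairing_conj_swap) simp
  qed
  \<comment> \<open>This value of \<open>t\<close> minimises \<open>1 - 2 t e\<^sup>2 + t\<^sup>2 C\<^sup>2\<close>; the minimum is \<open>q\<close>.\<close>
  define t where "t = e\<^sup>2 / C\<^sup>2"
  define q where "q = 1 - t * e\<^sup>2"
  have t: "t > 0" "t * C\<^sup>2 = e\<^sup>2"
    using C \<open>e > 0\<close> by (simp_all add: t_def)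
  have "t * e\<^sup>2 = (e\<^sup>2 / C)\<^sup>2"
    by (simp add: t_def power2_eq_square)
  also have "\<dots> \<le> 1"
    using C by (intro power_le_one) auto
  finally have q: "0 \<le> q" "q < 1"
    using t \<open>e > 0\<close> by (auto simp: q_def)
  have contr: "norm (x - t *\<^sub>R T x) \<le> sqrt q * norm x" for x
  proof -
    have "(norm (x - t *\<^sub>R T x))\<^sup>2 = (norm x)\<^sup>2 - 2 * t * (norm (H x))\<^sup>2 + t\<^sup>2 * (norm (T x))\<^sup>2"
    proof -
      define v where "v = cscale (of_real (- t)) (T x)"
      have *: "x - t *\<^sub>R T x = x + v"
        unfolding v_def cscale_of_real by simp
      have **: "Re (pairing x (conj_seq v)) = - t * (norm (H x))\<^sup>2"
        by (simp add: v_def conj_seq_cscale pairing_cscale_right T_pos)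
      show ?thesis
        unfolding * norm_sq_add ** by (simp add: v_def power_mult_distrib)
    qed
    also have "\<dots> \<le> (norm x)\<^sup>2 - 2 * t * (e * norm x)\<^sup>2 + t\<^sup>2 * (C * norm x)\<^sup>2"
      using low[of "conj_seq x"] \<open>e > 0\<close>
      by (intro add_mono diff_mono mult_left_mono power_mono T_bound order_refl)
        (use t in \<open>auto simp: H_def\<close>)
    also have "\<dots> = q * (norm x)\<^sup>2"
    proof -
      have "t\<^sup>2 * (C * norm x)\<^sup>2 = t * (t * C\<^sup>2) * (norm x)\<^sup>2"
        by (simp add: power2_eq_square)
      then show ?thesis
        unfolding t(2) by (simp add: q_def power_mult_distrib left_diff_distrib)
    qed
    finally show ?thesis
      using q by (intro power2_le_imp_le[of "norm (x - t *\<^sub>R T x)" "sqrt q * norm x"])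
        (auto simp: power_mult_distrib)
  qed
  \<comment> \<open>The fixed point equation says \<open>T x = y\<close>.\<close>
  have "\<exists>!x. x - t *\<^sub>R (T x - y) = x"
  proof (rule banach_fix_type[of "sqrt q"])
    show "\<forall>x x'. dist (x - t *\<^sub>R (T x - y)) (x' - t *\<^sub>R (T x' - y)) \<le> sqrt q * dist x x'"
    proof (intro allI)
      fix x x'
      have *: "x - t *\<^sub>R (T x - y) - (x' - t *\<^sub>R (T x' - y)) = (x - x') - t *\<^sub>R T (x - x')"
        by (simp add: T_diff algebra_simps)
      show "dist (x - t *\<^sub>R (T x - y)) (x' - t *\<^sub>R (T x' - y)) \<le> sqrt q * dist x x'"
        unfolding dist_norm * by (rule contr)
    qed
  qed (use q in auto)
  then obtain x where "t *\<^sub>R (T x - y) = 0" by (metis diff_eq_eq add_cancel_left_right)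
  then have "T x = y" using C \<open>e > 0\<close> by (simp add: t_def)
  then show "\<exists>x. y = mat_op B x" unfolding T_def by blast
qed

lemma inverse_norm_le_iff:
  assumes T: "bounded_linear T" and "e > 0"
  shows "inverse_norm T \<le> ereal (1 / e) \<longleftrightarrow> bij T \<and> (\<forall>x. e * norm x \<le> norm (T x))"
proof
  assume l: "inverse_norm T \<le> ereal (1 / e)"
  then have *: "bij T" "bounded_linear (inv T)" "onorm (inv T) \<le> 1 / e"
    by (auto simp: inverse_norm_def split: if_splits)
  have "e * norm x \<le> norm (T x)" for x
  proof -
    have "norm x = norm (inv T (T x))" using *(1) by (simp add: bij_is_inj)
    also have "\<dots> \<le> onorm (inv T) * norm (T x)" by (rule onorm[OF *(2)])
    also have "\<dots> \<le> 1 / e * norm (T x)" by (intro mult_right_mono *) simp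
    finally show ?thesis using \<open>e > 0\<close> by (simp add: field_simps)
  qed
  then show "bij T \<and> (\<forall>x. e * norm x \<le> norm (T x))" using * by blast
next
  assume r: "bij T \<and> (\<forall>x. e * norm x \<le> norm (T x))"
  then have inv: "T (inv T y) = y" for y
    by (simp add: bij_is_surj surj_f_inv_f)
  have bound: "norm (inv T y) \<le> norm y * (1 / e)" for y
    using r \<open>e > 0\<close> inv[of y] by (metis mult.commute divide_inverse inverse_eq_divide pos_le_divide_eq)
  have "bounded_linear (inv T)"
  proof (rule bounded_linear_intro[OF _ _ bound])
    fix x y r
    show "inv T (x + y) = inv T x + inv T y" "inv T (r *\<^sub>R x) = r *\<^sub>R inv T x"
      using r by (auto intro!: inv_f_eq bij_is_inj
          simp: inv linear_add[OF bounded_linear.linear[OF T]] linear_scale[OF bounded_linear.linear[OF T]])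
  qed
  moreover have "onorm (inv T) \<le> 1 / e"
    by (rule onorm_bound) (use bound \<open>e > 0\<close> in \<open>simp_all add: mult.commute\<close>)
  ultimately show "inverse_norm T \<le> ereal (1 / e)"
    using r by (simp add: inverse_norm_def)
qed

lemma not_in_pspec_iff:
  assumes "band_matrix A" "e > 0"
  shows "z \<notin> pspec e A \<longleftrightarrow> bij (mat_op (minus_scalar A z)) \<and>
           (\<forall>x. e * norm x \<le> norm (mat_op (minus_scalar A z) x))"
  using inverse_norm_le_iff[OF mat_op_bounded_linear[OF band_matrix_minus_scalar[OF assms(1)]] assms(2)]
  by (simp add: pspec_def not_less)

text \<open>The norm of the inverse is the reciprocal of the smaller of the lower norms of \<open>A - z\<close> and its
  adjoint. Lower bounds for both give injectivity and surjectivity; conversely, if the inverse \<open>R\<close>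
  exists and \<open>B = A - z\<close>, then \<open>\<parallel>y\<parallel>\<^sup>2 = pairing (B (R (conj_seq y))) y\<close>, and moving \<open>B\<close> to the other side
  bounds \<open>adj B\<close> below.\<close>

lemma in_pspec_iff:
  assumes A: "band_matrix A" and "e > 0"
  shows "z \<in> pspec e A \<longleftrightarrow> (\<exists>x. norm (mat_op (minus_scalar A z) x) < e * norm x) \<or>
           (\<exists>x. norm (mat_op (minus_scalar (adj A) z) x) < e * norm x)"
    (is "_ \<longleftrightarrow> ?P \<or> ?Q")
proof
  let ?B = "minus_scalar A z"
  have B: "band_matrix ?B" using A by simp
  assume z: "z \<in> pspec e A"
  show "?P \<or> ?Q"
  proof (rule ccontr)
    assume "\<not> (?P \<or> ?Q)"
    then have l: "\<And>x. e * norm x \<le> norm (mat_op ?B x)" "\<And>x. e * norm x \<le> norm (mat_op (adj ?B) x)"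
      by (auto simp: not_less adj_minus_scalar)
    have "inj (mat_op ?B)"
    proof (rule injI)
      fix x y assume "mat_op ?B x = mat_op ?B y"
      then show "x = y"
        using l(1)[of "x - y"] \<open>e > 0\<close> by (simp add: mat_op_diff[OF B] mult_le_0_iff)
    qed
    then show False
      using not_in_pspec_iff[OF A \<open>e > 0\<close>] z l(1) mat_op_surj_if_adj_bounded_below[OF B \<open>e > 0\<close> l(2)]
      by (auto simp: bij_def)
  qed
next
  let ?B = "minus_scalar A z"
  have B: "band_matrix ?B" using A by simp
  assume PQ: "?P \<or> ?Q"
  show "z \<in> pspec e A"
  proof (rule ccontr)
    assume "z \<notin> pspec e A"
    then have bij: "bij (mat_op ?B)" and l: "\<And>x. e * norm x \<le> norm (mat_op ?B x)"
      using not_in_pspec_iff[OF A \<open>e > 0\<close>] by auto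
    then obtain y where y: "norm (mat_op (adj ?B) y) < e * norm y"
      using PQ by (auto simp: adj_minus_scalar simp flip: not_le)
    obtain x where x: "mat_op ?B x = conj_seq y"
      using bij by (metis bij_pointE)
    have y0: "norm y > 0"
      using y \<open>e > 0\<close> norm_ge_zero[of "mat_op (adj ?B) y"] by (smt (verit) zero_less_mult_pos)
    have "x \<noteq> 0"
      using x y0 linear_0[OF linear_mat_op[OF B]]
      by (metis norm_conj_seq norm_zero less_irrefl)
    have "(norm y)\<^sup>2 = cmod (pairing (conj_seq y) y)"
      using pairing_conj_self[of y] by (simp add: pairing_commute norm_power)
    also have "\<dots> = cmod (pairing x (mat_op (adj ?B) y))"
      by (simp only: x[symmetric] pairing_mat_op[OF B])
    also have "\<dots> \<le> norm x * norm (mat_op (adj ?B) y)"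
      by (rule norm_pairing_le)
    also have "\<dots> < norm x * (e * norm y)"
      using y \<open>x \<noteq> 0\<close> by (intro mult_strict_left_mono) auto
    also have "\<dots> = (e * norm x) * norm y" by simp
    also have "\<dots> \<le> norm y * norm y"
      using l[of x] x by (intro mult_right_mono) auto
    finally show False by (simp add: power2_eq_square)
  qed
qed

section \<open>Strict decrease of the resolvent norm and continuity of pseudospectra\<close>

text \<open>The inverse function is arbitrary where \<open>A - z\<close> is not bijective; all statements below take \<open>z\<close> outside
  some pseudospectrum.\<close>

definition resolvent :: "bimat \<Rightarrow> complex \<Rightarrow> ell2 \<Rightarrow> ell2" where
  "resolvent A z = inv (mat_op (minus_scalar A z))"

lemma
  assumes "band_matrix A" "e > 0" "z \<notin> pspec e A"
  shows mat_op_resolvent: "mat_op (minus_scalar A z) (resolvent A z x) = x"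
    and resolvent_mat_op: "resolvent A z (mat_op (minus_scalar A z) x) = x"
    and norm_resolvent_le: "norm (resolvent A z x) \<le> norm x / e"
proof -
  have bij: "bij (mat_op (minus_scalar A z))"
    and low: "\<And>x. e * norm x \<le> norm (mat_op (minus_scalar A z) x)"
    using not_in_pspec_iff assms by auto
  show 1: "mat_op (minus_scalar A z) (resolvent A z x) = x"
    unfolding resolvent_def using bij by (simp add: bij_is_surj surj_f_inv_f)
  show "resolvent A z (mat_op (minus_scalar A z) x) = x"
    unfolding resolvent_def using bij by (simp add: bij_is_inj)
  show "norm (resolvent A z x) \<le> norm x / e"
    using low[of "resolvent A z x"] \<open>e > 0\<close> unfolding 1 by (simp add: field_simps)
qed

lemma resolvent_identity:
  assumes A: "band_matrix A" and e: "e > 0" and w: "w \<notin> pspec e A" and z: "z \<notin> pspec e A"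
  shows "resolvent A w x - resolvent A z x = cscale (w - z) (resolvent A w (resolvent A z x))"
proof -
  let ?M = "\<lambda>z. mat_op (minus_scalar A z)"
  let ?y = "resolvent A w x - resolvent A z x"
  have "?M w ?y = x - ?M w (resolvent A z x)"
    by (simp add: mat_op_diff A mat_op_resolvent[OF A e w])
  also have "?M w (resolvent A z x) = ?M z (resolvent A z x) - cscale (w - z) (resolvent A z x)"
    by (rule ell2_eqI) (simp add: mat_op_minus_scalar A seq_diff seq_add algebra_simps)
  also have "x - \<dots> = cscale (w - z) (resolvent A z x)"
    by (simp add: mat_op_resolvent[OF A e z])
  also have "\<dots> = ?M w (cscale (w - z) (resolvent A w (resolvent A z x)))"
    by (simp add: mat_op_cscale A mat_op_resolvent[OF A e w])
  finally show ?thesis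
    by (metis resolvent_mat_op[OF A e w])
qed

text \<open>By the resolvent identity the difference quotient of the resolvent at \<open>z\<close> is the product of the
  resolvents at \<open>w\<close> and \<open>z\<close>; the uniform bound \<open>1 / e\<close> on \<open>U\<close> makes it converge.\<close>

lemma resolvent_pairing_holomorphic:
  assumes A: "band_matrix A" and e: "e > 0" and U: "open U" and res: "\<And>w. w \<in> U \<Longrightarrow> w \<notin> pspec e A"
  shows "(\<lambda>w. pairing (resolvent A w x) y) holomorphic_on U"
proof -
  have diff: "pairing (resolvent A w x) y - pairing (resolvent A z x) y
      = (w - z) * pairing (resolvent A w (resolvent A z x)) y" if "z \<in> U" "w \<in> U" for z w x
    using resolvent_identity[OF A e res res, of w z x] that
    by (simp flip: pairing_diff_left add: pairing_cscale_left)
  have cont: "((\<lambda>w. pairing (resolvent A w x) y) \<longlongrightarrow> pairing (resolvent A z x) y) (at z)"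
    if z: "z \<in> U" for z x
  proof -
    define K where "K = norm x / e / e * norm y"
    have "((\<lambda>w. pairing (resolvent A w x) y - pairing (resolvent A z x) y) \<longlongrightarrow> 0) (at z)"
    proof (rule Lim_null_comparison)
      show "\<forall>\<^sub>F w in at z. norm (pairing (resolvent A w x) y - pairing (resolvent A z x) y)
          \<le> cmod (w - z) * K"
      proof (rule eventually_at_in_open'[OF U z, THEN eventually_mono])
        fix w assume w: "w \<in> U"
        have "cmod (pairing (resolvent A w (resolvent A z x)) y)
            \<le> norm (resolvent A w (resolvent A z x)) * norm y"
          by (rule norm_pairing_le)
        also have "\<dots> \<le> norm (resolvent A z x) / e * norm y"
          by (intro mult_right_mono norm_resolvent_le[OF A e res[OF w]]) simp
        also have "\<dots> \<le> norm x / e / e * norm y"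
          using e by (intro mult_right_mono divide_right_mono norm_resolvent_le[OF A e res[OF z]]) auto
        finally have "cmod (pairing (resolvent A w (resolvent A z x)) y) \<le> K"
          by (simp add: K_def)
        then show "norm (pairing (resolvent A w x) y - pairing (resolvent A z x) y)
          \<le> cmod (w - z) * K"
          unfolding diff[OF z w] norm_mult by (intro mult_left_mono) auto
      qed
      show "((\<lambda>w. cmod (w - z) * K) \<longlongrightarrow> 0) (at z)"
        by (auto intro!: tendsto_eq_intros)
    qed
    then show ?thesis by (simp add: LIM_zero_iff)
  qed
  have "((\<lambda>w. pairing (resolvent A w x) y) has_field_derivative
      pairing (resolvent A z (resolvent A z x)) y) (at z)" if z: "z \<in> U" for z
    unfolding has_field_derivative_iff
  proof (rule Lim_transform_within_open[OF cont[OF z] U z])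
    fix w assume "w \<in> U" "w \<noteq> z"
    then show "pairing (resolvent A w (resolvent A z x)) y =
         (pairing (resolvent A w x) y - pairing (resolvent A z x) y) / (w - z)"
      using diff[OF z, of w x] by simp
  qed
  then show ?thesis
    using U holomorphic_on_open by blast
qed

text \<open>If the resolvent norm is at most \<open>1 / e\<close> throughout a disc, it is smaller than that at the centre by
  a definite factor. In particular it cannot be constant on an open set. In general Banach
  spaces it can; the proof uses the inner product. The reason is that \<open>s \<mapsto> R (z + s) x\<close> has Taylor
  coefficients \<open>u = R z x\<close> and \<open>v = R z u\<close> at \<open>0\<close>, so its mean square over \<open>\<bar>s\<bar> = r\<close> is at least
  \<open>\<parallel>u\<parallel>\<^sup>2 + r\<^sup>2 \<parallel>v\<parallel>\<^sup>2\<close>, while \<open>\<parallel>u\<parallel> \<le> C \<parallel>v\<parallel>\<close>.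

  Integration over the circle is avoided by the maximum principle. The function
  \<open>k s = \<langle>R (z + s) x, u\<rangle> + r\<^sup>2 \<langle>R (z + s) u, v\<rangle>\<close> is holomorphic, with
  \<open>k 0 = \<parallel>u\<parallel>\<^sup>2 + r\<^sup>2 \<parallel>v\<parallel>\<^sup>2\<close>. On the circle \<open>r\<^sup>2 = cnj s * s\<close>, so the resolvent identity
  gives \<open>k s = \<langle>R (z + s) x, u + s v\<rangle> - cnj s * \<langle>u, v\<rangle>\<close>. When the first term is bounded by half the sum
  of the squared norms, the cross term of \<open>\<parallel>u + s v\<parallel>\<^sup>2\<close> cancels the second term, and what remains does
  not depend on \<open>s\<close>.\<close>

lemma lower_bound_gain:
  assumes A: "band_matrix A" and e: "e > 0"
    and res: "\<And>w. w \<in> ball z \<eta> \<Longrightarrow> w \<notin> pspec e A"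
    and r: "0 < r" "r < \<eta>"
    and C: "C > 0" "\<And>x. norm (mat_op (minus_scalar A z) x) \<le> C * norm x"
  shows "e\<^sup>2 * (1 + r\<^sup>2 / C\<^sup>2) * (norm u)\<^sup>2 \<le> (norm (mat_op (minus_scalar A z) u))\<^sup>2"
proof -
  define x where "x = mat_op (minus_scalar A z) u"
  define v where "v = resolvent A z u"
  have z: "z \<notin> pspec e A" using res r by simp
  have x: "resolvent A z x = u"
    unfolding x_def by (rule resolvent_mat_op[OF A e z])
  define k where "k s = pairing (resolvent A (s + z) x) (conj_seq u)
      + r\<^sup>2 * pairing (resolvent A (s + z) u) (conj_seq v)" for s
  let ?B = "((norm x / e)\<^sup>2 + (norm u)\<^sup>2 + r\<^sup>2 * (norm v)\<^sup>2) / 2"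
  have "(\<lambda>w. pairing (resolvent A w x) y) \<circ> (\<lambda>s. s + z) holomorphic_on ball 0 \<eta>" for x y
  proof (rule holomorphic_on_compose_gen)
    show "(\<lambda>w. pairing (resolvent A w x) y) holomorphic_on ball z \<eta>"
      by (rule resolvent_pairing_holomorphic[OF A e open_ball res])
  qed (auto intro!: holomorphic_intros simp: dist_norm)
  then have hol: "k holomorphic_on ball 0 \<eta>"
    unfolding k_def o_def by (intro holomorphic_intros)
  have "Re (k 0) \<le> ?B"
  proof (rule maximum_real_frontier[of k "ball 0 r"])
    show "k holomorphic_on interior (ball 0 r)"
      using r by (intro holomorphic_on_subset[OF hol]) auto
    show "continuous_on (closure (ball 0 r)) k"
      using r by (intro continuous_on_subset[OF holomorphic_on_imp_continuous_on[OF hol]]) auto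
    fix s :: complex assume "s \<in> frontier (ball 0 r)"
    then have s: "cmod s = r" using r by simp
    define F where "F = resolvent A (s + z) x"
    define p where "p = u + cscale s v"
    have w: "s + z \<notin> pspec e A" using s r by (intro res) (simp add: dist_norm)
    have "F - u = cscale s (resolvent A (s + z) u)"
      using resolvent_identity[OF A e w z, of x] by (simp add: F_def x)
    then have "pairing (F - u) (conj_seq v) = s * pairing (resolvent A (s + z) u) (conj_seq v)"
      by (simp add: pairing_cscale_left)
    moreover have "r\<^sup>2 = cnj s * s"
      using s complex_norm_square[of s] by (simp add: mult.commute)
    ultimately have "r\<^sup>2 * pairing (resolvent A (s + z) u) (conj_seq v)
        = cnj s * pairing (F - u) (conj_seq v)"
      by simp
    then have k: "k s = pairing F (conj_seq p) - cnj s * pairing u (conj_seq v)"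
      by (simp add: k_def F_def[symmetric] p_def conj_seq_add conj_seq_cscale pairing_add_right
          pairing_cscale_right pairing_diff_left right_diff_distrib)
    have "Re (pairing F (conj_seq p)) \<le> norm F * norm p"
      using complex_Re_le_cmod[of "pairing F (conj_seq p)"] norm_pairing_le[of F "conj_seq p"] by simp
    also have "\<dots> \<le> ((norm F)\<^sup>2 + (norm p)\<^sup>2) / 2"
      using sum_squares_bound[of "norm F" "norm p"] by simp
    also have "\<dots> \<le> ((norm x / e)\<^sup>2 + (norm p)\<^sup>2) / 2"
      using norm_resolvent_le[OF A e w, of x] by (intro divide_right_mono add_right_mono power_mono) (auto simp: F_def)
    finally have "Re (pairing F (conj_seq p)) \<le> ((norm x / e)\<^sup>2 + (norm p)\<^sup>2) / 2" .
    moreover have "(norm p)\<^sup>2 = (norm u)\<^sup>2 + 2 * Re (cnj s * pairing u (conj_seq v)) + r\<^sup>2 * (norm v)\<^sup>2"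
      unfolding p_def norm_sq_add conj_seq_cscale pairing_cscale_right
      by (simp add: s power_mult_distrib)
    ultimately show "Re (k s) \<le> ?B"
      unfolding k minus_complex.sel by argo
  qed (use r in auto)
  moreover have "Re (k 0) = (norm u)\<^sup>2 + r\<^sup>2 * (norm v)\<^sup>2"
    by (simp add: k_def x pairing_conj_self flip: v_def of_real_power of_real_mult)
  ultimately have "(norm u)\<^sup>2 + r\<^sup>2 * (norm v)\<^sup>2 \<le> (norm x / e)\<^sup>2"
    by argo
  moreover have "norm u \<le> C * norm v"
    using C(2)[of v] mat_op_resolvent[OF A e z, of u] by (simp add: v_def)
  then have "(norm u / C)\<^sup>2 \<le> (norm v)\<^sup>2"
    using C by (intro power_mono) (auto simp: field_simps)
  then have "r\<^sup>2 * (norm u / C)\<^sup>2 \<le> r\<^sup>2 * (norm v)\<^sup>2"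
    by (intro mult_left_mono) auto
  ultimately have "(norm u)\<^sup>2 + r\<^sup>2 * (norm u / C)\<^sup>2 \<le> (norm x / e)\<^sup>2"
    by linarith
  then have "e\<^sup>2 * ((norm u)\<^sup>2 + r\<^sup>2 * (norm u / C)\<^sup>2) \<le> e\<^sup>2 * (norm x / e)\<^sup>2"
    by (intro mult_left_mono) auto
  then show ?thesis
    using e by (simp add: x_def power_divide algebra_simps)
qed

definition unit_seq :: "int \<Rightarrow> ell2" where
  "unit_seq j = Abs_ell2 (\<lambda>i. if i = j then 1 else 0)"

lemma
  shows seq_unit_seq: "seq (unit_seq j) i = (if i = j then 1 else 0)"
    and norm_unit_seq [simp]: "norm (unit_seq j) = 1"
proof -
  have *: "((\<lambda>i. (cmod (if i = j then 1 else 0))\<^sup>2) has_sum 1) UNIV"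
    by (rule has_sum_finite_neutralI[of "{j}"]) auto
  then have **: "seq (unit_seq j) = (\<lambda>i. if i = j then 1 else 0)"
    unfolding unit_seq_def by (intro seq_Abs_ell2) (rule has_sum_imp_summable)
  then show "seq (unit_seq j) i = (if i = j then 1 else 0)" by simp
  show "norm (unit_seq j) = 1"
    unfolding norm_ell2_def ** infsumI[OF *] by simp
qed

lemma mat_op_bound:
  assumes "band_matrix A"
  obtains L where "L > 0" "\<And>x. norm (mat_op A x) \<le> L * norm x"
  using bounded_linear.pos_bounded[OF mat_op_bounded_linear[OF assms]] by (metis mult.commute)

lemma mat_op_minus_scalar_bounds:
  assumes "band_matrix A" "\<And>x. norm (mat_op A x) \<le> L * norm x"
  shows "norm (mat_op (minus_scalar A z) x) \<le> (L + cmod z) * norm x"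
    and "(cmod z - L) * norm x \<le> norm (mat_op (minus_scalar A z) x)"
proof -
  have *: "mat_op (minus_scalar A z) x = mat_op A x - cscale z x"
    by (rule mat_op_minus_scalar[OF assms(1)])
  show "norm (mat_op (minus_scalar A z) x) \<le> (L + cmod z) * norm x"
    unfolding * using norm_triangle_ineq4[of "mat_op A x" "cscale z x"] assms(2)[of x]
    by (simp add: distrib_right)
  show "(cmod z - L) * norm x \<le> norm (mat_op (minus_scalar A z) x)"
    unfolding * using norm_triangle_ineq2[of "cscale z x" "mat_op A x"] assms(2)[of x]
    by (simp add: left_diff_distrib norm_minus_commute)
qed

lemma pspec_bound:
  assumes "band_matrix A"
  obtains L where "L > 0" "\<And>x. norm (mat_op A x) \<le> L * norm x"
    "\<And>e z. e > 0 \<Longrightarrow> z \<in> pspec e A \<Longrightarrow> cmod z < L + e"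
proof -
  obtain L where L: "L > 0" "\<And>x. norm (mat_op A x) \<le> L * norm x"
    using mat_op_bound[OF assms] by metis
  obtain L' where L': "L' > 0" "\<And>x. norm (mat_op (adj A) x) \<le> L' * norm x"
    using mat_op_bound[OF band_matrix_adj[OF assms]] by metis
  have b: "norm (mat_op A x) \<le> (L + L') * norm x" "norm (mat_op (adj A) x) \<le> (L + L') * norm x" for x
    using L(2)[of x] L'(2)[of x] L(1) L'(1) by (simp_all add: distrib_right add_increasing add_increasing2)
  have *: "cmod z < L + L' + e"
    if "(cmod z - (L + L')) * norm x \<le> a" "a < e * norm x" for a z e x
  proof -
    have "(cmod z - (L + L')) * norm x < e * norm x" using that by linarith
    then show ?thesis by (simp add: mult_less_cancel_right)
  qed
  have "cmod z < L + L' + e" if "e > 0" "z \<in> pspec e A" for e z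
    using that(2) unfolding in_pspec_iff[OF assms that(1)]
    using *[OF mat_op_minus_scalar_bounds(2)[OF assms b(1)]]
      *[OF mat_op_minus_scalar_bounds(2)[OF band_matrix_adj[OF assms] b(2)]] by blast
  then show ?thesis using that[of "L + L'"] b L(1) L'(1) by auto
qed

text \<open>If the resolvent were bounded by \<open>1 / e\<close> everywhere, the gain in \<open>lower_bound_gain\<close> would be
  available for discs of any radius and would contradict the boundedness of \<open>A\<close>. The radius \<open>L\<^sup>2 / e\<close> is
  large enough.\<close>

lemma pspec_nonempty:
  assumes A: "band_matrix A" and e: "e > 0"
  shows "pspec e A \<noteq> {}"
proof
  assume "pspec e A = {}"
  obtain L where L: "L > 0" "\<And>x. norm (mat_op A x) \<le> L * norm x"
    using mat_op_bound[OF A] by metis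
  let ?u = "unit_seq 0"
  have b: "norm (mat_op (minus_scalar A 0) x) \<le> L * norm x" for x
    using mat_op_minus_scalar_bounds(1)[OF A L(2), of 0 x] by simp
  have "e\<^sup>2 * (1 + (L\<^sup>2 / e)\<^sup>2 / L\<^sup>2) * (norm ?u)\<^sup>2 \<le> (norm (mat_op (minus_scalar A 0) ?u))\<^sup>2"
    by (rule lower_bound_gain[OF A e, where \<eta> = "L\<^sup>2 / e + 1"])
      (use \<open>pspec e A = {}\<close> L b e in auto)
  also have "\<dots> \<le> L\<^sup>2"
    using b[of ?u] by (intro power_mono) auto
  also have "(L\<^sup>2 / e)\<^sup>2 / L\<^sup>2 = L\<^sup>2 / e\<^sup>2"
    by (simp add: power2_eq_square)
  finally have "e\<^sup>2 + L\<^sup>2 \<le> L\<^sup>2"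
    using e by (simp add: distrib_left)
  then show False using e by simp
qed

lemma bounded_pspec:
  assumes "band_matrix A" "e > 0"
  shows "bounded (pspec e A)"
  using pspec_bound[OF assms(1)] assms(2) by (metis boundedI less_imp_le)

text \<open>Continuity of the pseudospectrum in the level. A point \<open>z\<close> of \<open>pspec (a n) A\<close> at distance at least
  \<open>\<eta>\<close> from \<open>pspec (b n) A\<close> would have a resolvent bounded by \<open>1 / b n\<close> on a disc of radius \<open>\<eta>\<close>, hence by
  \<open>1 / (b n * sqrt (1 + h))\<close> at \<open>z\<close>, with \<open>h > 0\<close> independent of \<open>n\<close>; this is incompatible with
  \<open>z \<in> pspec (a n) A\<close> once \<open>a n\<close> and \<open>b n\<close> are close.\<close>

lemma pspec_eventually_near:
  assumes A: "band_matrix A" and e: "e > 0" and \<eta>: "\<eta> > 0"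
    and a: "a \<longlonglongrightarrow> e" and b: "b \<longlonglongrightarrow> e"
  shows "\<forall>\<^sub>F n in sequentially. \<forall>z\<in>pspec (a n) A. \<exists>w\<in>pspec (b n) A. dist z w < \<eta>"
proof -
  obtain L where L: "L > 0" "\<And>x. norm (mat_op A x) \<le> L * norm x"
    "\<And>e z. e > 0 \<Longrightarrow> z \<in> pspec e A \<Longrightarrow> cmod z < L + e"
    using pspec_bound[OF A] by metis
  \<comment> \<open>A bound for \<open>\<parallel>A - z\<parallel>\<close> that holds for all \<open>z\<close> in the pseudospectra of level below \<open>2 e\<close>.\<close>
  define C where "C = L + (L + 2 * e)"
  have C: "C > 0" using L e by (simp add: C_def)
  \<comment> \<open>The gain is available for radii strictly below \<open>\<eta>\<close>; \<open>\<eta> / 2\<close> is used.\<close>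
  define h where "h = (\<eta> / 2)\<^sup>2 / C\<^sup>2"
  have h: "h > 0" using \<eta> C by (simp add: h_def)
  have "(\<lambda>n. (b n)\<^sup>2 * (1 + h) - (a n)\<^sup>2) \<longlonglongrightarrow> e\<^sup>2 * (1 + h) - e\<^sup>2"
    by (intro tendsto_intros a b)
  then have "\<forall>\<^sub>F n in sequentially. (b n)\<^sup>2 * (1 + h) - (a n)\<^sup>2 > 0"
    by (rule order_tendstoD) (use e h in \<open>simp add: algebra_simps\<close>)
  moreover have "\<forall>\<^sub>F n in sequentially. a n > 0" "\<forall>\<^sub>F n in sequentially. b n > 0"
    "\<forall>\<^sub>F n in sequentially. a n < 2 * e"
    using order_tendstoD[OF a] order_tendstoD[OF b] e by auto
  ultimately show ?thesis
  proof eventually_elim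
    case (elim n)
    show ?case
    proof
      fix z assume z: "z \<in> pspec (a n) A"
      have "norm (mat_op (minus_scalar A z) x) \<le> C * norm x" for x
      proof -
        have "norm (mat_op (minus_scalar A z) x) \<le> (L + cmod z) * norm x"
          by (rule mat_op_minus_scalar_bounds(1)[OF A L(2)])
        also have "\<dots> \<le> C * norm x"
          using L(3)[OF _ z] elim by (intro mult_right_mono) (auto simp: C_def)
        finally show ?thesis .
      qed
      note C_bound = this
      show "\<exists>w\<in>pspec (b n) A. dist z w < \<eta>"
      proof (rule ccontr)
        assume "\<not> ?thesis"
        then have res: "w \<notin> pspec (b n) A" if "w \<in> ball z \<eta>" for w
          using that by auto
        have "a n * norm u \<le> norm (mat_op (minus_scalar A z) u)" for u
        proof (rule power2_le_imp_le)
          have "(a n * norm u)\<^sup>2 \<le> (b n)\<^sup>2 * (1 + h) * (norm u)\<^sup>2"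
            unfolding power_mult_distrib using elim by (intro mult_right_mono) auto
          also have "\<dots> \<le> (norm (mat_op (minus_scalar A z) u))\<^sup>2"
            unfolding h_def
            by (rule lower_bound_gain[OF A _ res]) (use elim C C_bound \<eta> in auto)
          finally show "(a n * norm u)\<^sup>2 \<le> (norm (mat_op (minus_scalar A z) u))\<^sup>2" .
        qed simp
        moreover have "bij (mat_op (minus_scalar A z))"
          using res[of z] \<eta> elim not_in_pspec_iff[OF A, of "b n" z] by simp
        ultimately have "z \<notin> pspec (a n) A"
          using not_in_pspec_iff[OF A, of "a n" z] elim by simp
        then show False using z by simp
      qed
    qed
  qed
qed

section \<open>Blocks and weighted windows\<close>

abbreviation block_of :: "int \<Rightarrow> nat \<Rightarrow> int \<Rightarrow> int" where
  "block_of c d j \<equiv> (j - c) div int d"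

definition block_norm_sq :: "int \<Rightarrow> nat \<Rightarrow> ell2 \<Rightarrow> int \<Rightarrow> real" where
  "block_norm_sq c d x i = (\<Sum>r<d. (cmod (seq x (c + int d * i + int r)))\<^sup>2)"

lemma block_of_index: "r < d \<Longrightarrow> block_of c d (c + int d * i + int r) = i"
  by (simp add: div_pos_pos_trivial)

lemma block_norm_sq_has_sum:
  assumes "d > 0"
  shows "(block_norm_sq c d x has_sum (norm x)\<^sup>2) UNIV"
proof (rule has_sum_SigmaD)
  let ?h = "\<lambda>(i, r). c + int d * i + int r"
  have "bij_betw ?h (UNIV \<times> {..<d}) UNIV"
    by (rule bij_betw_byWitness[where f' = "\<lambda>j. (block_of c d j, nat ((j - c) mod int d))"])
      (use assms in \<open>auto simp: nat_less_iff\<close>)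
  from has_sum_reindex_bij_betw[OF this, of "\<lambda>j. (cmod (seq x j))\<^sup>2" "(norm x)\<^sup>2"]
  show "((\<lambda>p. (cmod (seq x (?h p)))\<^sup>2) has_sum (norm x)\<^sup>2) (Sigma UNIV (\<lambda>_. {..<d}))"
    using norm_sq_has_sum by simp
  show "((\<lambda>r. (cmod (seq x (?h (i, r))))\<^sup>2) has_sum block_norm_sq c d x i) {..<d}" for i
    by (simp add: block_norm_sq_def)
qed

text \<open>Arbitrary if the weighted sequence is not square summable. In all uses below \<open>f\<close> takes only finitely
  many values.\<close>

definition reweight :: "(int \<Rightarrow> real) \<Rightarrow> ell2 \<Rightarrow> ell2" where
  "reweight f x = Abs_ell2 (\<lambda>j. of_real (f j) * seq x j)"

text \<open>The weight is a finitely supported \<open>u\<close> composed with an index map \<open>h\<close>: below, \<open>h j\<close> is the position of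
  the block of \<open>j\<close> relative to a window.\<close>

lemma seq_reweight:
  assumes "finite M" "\<And>m. m \<notin> M \<Longrightarrow> u m = 0"
  shows "seq (reweight (\<lambda>j. u (h j)) x) j = of_real (u (h j)) * seq x j"
proof -
  have u: "\<bar>u m\<bar> \<le> (\<Sum>m\<in>M. \<bar>u m\<bar>)" for m
    using assms member_le_sum[of m M "\<lambda>m. \<bar>u m\<bar>"] by (cases "m \<in> M") (auto simp: sum_nonneg)
  have "(\<lambda>j. (cmod (of_real (u (h j)) * seq x j))\<^sup>2) summable_on UNIV"
  proof (rule summable_on_comparison_test)
    show "(\<lambda>j. (\<Sum>m\<in>M. \<bar>u m\<bar>)\<^sup>2 * (cmod (seq x j))\<^sup>2) summable_on UNIV"
      by (intro summable_on_cmult_right seq_summable)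
    fix j
    show "(cmod (of_real (u (h j)) * seq x j))\<^sup>2 \<le> (\<Sum>m\<in>M. \<bar>u m\<bar>)\<^sup>2 * (cmod (seq x j))\<^sup>2"
      unfolding norm_mult power_mult_distrib
      by (intro mult_right_mono power_mono) (use u in auto)
  qed auto
  then show ?thesis
    unfolding reweight_def by (subst seq_Abs_ell2) auto
qed

text \<open>As \<open>k\<close> varies, every block is met by every value of \<open>u\<close> exactly once.\<close>

lemma sum_norm_sq_windows:
  assumes d: "d > 0" and M: "finite M" "\<And>m. m \<notin> M \<Longrightarrow> u m = 0"
  shows "((\<lambda>k. (norm (reweight (\<lambda>j. u (block_of c d j - k)) x))\<^sup>2)
           has_sum ((\<Sum>m\<in>M. (u m)\<^sup>2) * (norm x)\<^sup>2)) UNIV"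
proof -
  let ?N = "block_norm_sq c d"
  have "(norm (reweight (\<lambda>j. u (block_of c d j - k)) x))\<^sup>2 = (\<Sum>m\<in>M. (u m)\<^sup>2 * ?N x (k + m))" for k
  proof (rule has_sum_unique[OF block_norm_sq_has_sum[OF d]])
    let ?y = "reweight (\<lambda>j. u (block_of c d j - k)) x"
    have y: "seq ?y j = of_real (u (block_of c d j - k)) * seq x j" for j
      by (rule seq_reweight[OF M, where h = "\<lambda>j. block_of c d j - k"])
    have N: "?N ?y i = (u (i - k))\<^sup>2 * ?N x i" for i
      unfolding block_norm_sq_def sum_distrib_left y
      by (rule sum.cong) (auto simp only: lessThan_iff block_of_index norm_mult norm_of_real power_mult_distrib power2_abs)
    show "(?N ?y has_sum (\<Sum>m\<in>M. (u m)\<^sup>2 * ?N x (k + m))) UNIV"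
    proof (rule has_sum_finite_neutralI[of "(\<lambda>m. k + m) ` M"])
      show "?N ?y i = 0" if "i \<in> UNIV - (\<lambda>m. k + m) ` M" for i
      proof -
        have "i - k \<notin> M" using that by (auto simp: image_iff algebra_simps)
        then show ?thesis by (simp add: N M)
      qed
      show "(\<Sum>m\<in>M. (u m)\<^sup>2 * ?N x (k + m)) = sum (?N ?y) ((\<lambda>m. k + m) ` M)"
        by (simp add: sum.reindex N)
    qed (use M in auto)
  qed
  moreover have "((\<lambda>k. \<Sum>m\<in>M. (u m)\<^sup>2 * ?N x (k + m)) has_sum (\<Sum>m\<in>M. (u m)\<^sup>2 * (norm x)\<^sup>2)) UNIV"
  proof (rule has_sum_sum_finite[OF M(1)])
    fix m
    have "bij_betw (\<lambda>k. k + m) UNIV (UNIV :: int set)"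
      by (rule bij_betw_byWitness[where f' = "\<lambda>i. i - m"]) auto
    then have "((\<lambda>k. ?N x (k + m)) has_sum (norm x)\<^sup>2) UNIV"
      by (subst has_sum_reindex_bij_betw[of _ UNIV UNIV "?N x"]) (auto intro: block_norm_sq_has_sum[OF d])
    then show "((\<lambda>k. (u m)\<^sup>2 * ?N x (k + m)) has_sum (u m)\<^sup>2 * (norm x)\<^sup>2) UNIV"
      by (rule has_sum_cmult_right)
  qed
  ultimately show ?thesis
    by (simp add: sum_distrib_right)
qed

lemma L2_set_norm_windows_le:
  assumes "d > 0" "finite M" "\<And>m. m \<notin> M \<Longrightarrow> u m = 0" "finite F"
  shows "L2_set (\<lambda>k. norm (reweight (\<lambda>j. u (block_of c d j - k)) x)) F
           \<le> sqrt (\<Sum>m\<in>M. (u m)\<^sup>2) * norm x"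
proof -
  note hs = sum_norm_sq_windows[OF assms(1-3), where c = c and x = x]
  have "(\<Sum>k\<in>F. (norm (reweight (\<lambda>j. u (block_of c d j - k)) x))\<^sup>2) \<le> (\<Sum>m\<in>M. (u m)\<^sup>2) * (norm x)\<^sup>2"
    using finite_sum_le_infsum[OF has_sum_imp_summable[OF hs] assms(4)] infsumI[OF hs] by simp
  from real_sqrt_le_mono[OF this] show ?thesis
    by (simp add: L2_set_def real_sqrt_mult)
qed

section \<open>Block diagonals of a matrix\<close>

text \<open>A bound for the operator norm that avoids the supremum in \<open>matrix_norm\<close> and is easily transposed.\<close>

definition mat_bound :: "nat \<Rightarrow> (nat \<Rightarrow> nat \<Rightarrow> complex) \<Rightarrow> real \<Rightarrow> bool" where
  "mat_bound d M a \<longleftrightarrow> (\<forall>v. L2_set (\<lambda>r. cmod (\<Sum>s<d. M r s * v s)) {..<d}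
      \<le> a * L2_set (\<lambda>s. cmod (v s)) {..<d})"

lemma matrix_norm_entries:
  assumes "\<And>r s. cmod (M r s) \<le> K"
  shows "bdd_above ((\<lambda>v. L2_set (\<lambda>r. cmod (\<Sum>s<d. M r s * v s)) {..<d}) `
            {v. L2_set (\<lambda>s. cmod (v s)) {..<d} \<le> 1})" (is "bdd_above (?f ` ?S)")
    and "matrix_norm d M \<le> real d * (real d * K)"
    and "0 \<le> matrix_norm d M"
    and "mat_bound d M (matrix_norm d M)"
proof -
  have K: "0 \<le> K" using assms[of 0 0] norm_ge_zero[of "M 0 0"] by linarith
  have le: "?f v \<le> real d * (real d * K)" if "v \<in> ?S" for v
  proof -
    have v: "cmod (v s) \<le> 1" if "s < d" for s
      using \<open>v \<in> ?S\<close> member_le_L2_set[of "{..<d}" s "\<lambda>s. cmod (v s)"] that by simp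
    have "cmod (\<Sum>s<d. M r s * v s) \<le> real (card {..<d}) * K" for r
    proof (rule sum_norm_bound)
      fix s assume "s \<in> {..<d}"
      then show "cmod (M r s * v s) \<le> K"
        using mult_mono[OF assms[of r s] v[of s]] K by (simp add: norm_mult)
    qed
    then have "(\<Sum>r<d. cmod (\<Sum>s<d. M r s * v s)) \<le> (\<Sum>r<d. real d * K)"
      by (intro sum_mono) simp
    moreover have "?f v \<le> (\<Sum>r<d. cmod (\<Sum>s<d. M r s * v s))"
      by (rule L2_set_le_sum) simp
    ultimately show ?thesis by simp
  qed
  then show bdd: "bdd_above (?f ` ?S)" by (rule bdd_aboveI2)
  have zero: "(\<lambda>_. 0) \<in> ?S" by (simp add: L2_set_def)
  show "matrix_norm d M \<le> real d * (real d * K)"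
    unfolding matrix_norm_def
  proof (rule cSUP_least)
    show "?S \<noteq> {}" using zero by (metis empty_iff)
  qed (rule le)
  show nonneg: "0 \<le> matrix_norm d M"
    unfolding matrix_norm_def using cSUP_upper[OF zero bdd] by (simp add: L2_set_def)
  show "mat_bound d M (matrix_norm d M)"
    unfolding mat_bound_def
  proof
    fix v :: "nat \<Rightarrow> complex"
    let ?n = "L2_set (\<lambda>s. cmod (v s)) {..<d}"
    show "?f v \<le> matrix_norm d M * ?n"
    proof (cases "?n = 0")
      case True
      then have "v s = 0" if "s < d" for s
        using that by (simp add: L2_set_eq_0_iff)
      then show ?thesis using True by (simp add: L2_set_def)
    next
      case False
      then have n: "?n > 0" using L2_set_nonneg[of "\<lambda>s. cmod (v s)" "{..<d}"] by linarith
      define t where "t = 1 / ?n"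
      have t: "t > 0" "t * ?n = 1" using n by (simp_all add: t_def)
      let ?w = "\<lambda>s. of_real t * v s"
      have scale: "L2_set (\<lambda>s. cmod (of_real t * g s)) {..<d} = t * L2_set (\<lambda>s. cmod (g s)) {..<d}" for g
        using t by (simp add: norm_mult L2_set_right_distrib)
      have "?w \<in> ?S" using scale[of v] t by simp
      from cSUP_upper[OF this bdd] have "?f ?w \<le> matrix_norm d M"
        by (simp only: matrix_norm_def)
      moreover have "(\<Sum>s<d. M r s * ?w s) = of_real t * (\<Sum>s<d. M r s * v s)" for r
        by (simp only: sum_distrib_left mult.left_commute)
      ultimately have "t * ?f v \<le> matrix_norm d M * (t * ?n)"
        using t by (simp only: scale mult_1_right)
      then have "t * ?f v \<le> t * (matrix_norm d M * ?n)"
        by (simp only: mult.left_commute)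
      then show ?thesis using t(1) by (simp only: mult_le_cancel_left_pos)
    qed
  qed
qed

text \<open>With \<open>y\<close> the image of \<open>v\<close> under the transpose, \<open>\<parallel>y\<parallel>\<^sup>2\<close> is the pairing of \<open>v\<close> with the image of the
  conjugate of \<open>y\<close> under \<open>M\<close>.\<close>

lemma mat_bound_transpose:
  assumes M: "mat_bound d M a" and a: "0 \<le> a"
  shows "mat_bound d (\<lambda>r s. M s r) a"
  unfolding mat_bound_def
proof
  fix v :: "nat \<Rightarrow> complex"
  define y where "y r = (\<Sum>s<d. M s r * v s)" for r
  let ?n = "\<lambda>f. L2_set (\<lambda>s. cmod (f s)) {..<d}"
  have "complex_of_real ((?n y)\<^sup>2) = (\<Sum>r<d. cnj (y r) * (\<Sum>s<d. M s r * v s))"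
    unfolding y_def[symmetric]
    by (simp add: L2_set_def sum_nonneg complex_norm_square mult.commute del: of_real_power)
  also have "\<dots> = (\<Sum>s<d. v s * (\<Sum>r<d. M s r * cnj (y r)))"
    unfolding sum_distrib_left by (subst sum.swap) (simp add: mult_ac)
  finally have "(?n y)\<^sup>2 = cmod (\<Sum>s<d. v s * (\<Sum>r<d. M s r * cnj (y r)))"
    by (metis norm_of_real abs_of_nonneg zero_le_power2)
  also have "\<dots> \<le> (\<Sum>s<d. \<bar>cmod (v s)\<bar> * \<bar>cmod (\<Sum>r<d. M s r * cnj (y r))\<bar>)"
    by (rule sum_norm_le) (simp add: norm_mult)
  also have "\<dots> \<le> ?n v * ?n (\<lambda>s. \<Sum>r<d. M s r * cnj (y r))"
    by (rule L2_set_mult_ineq)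
  also have "\<dots> \<le> ?n v * (a * ?n (\<lambda>r. cnj (y r)))"
    using M[unfolded mat_bound_def, rule_format, of "\<lambda>r. cnj (y r)"]
    by (intro mult_left_mono L2_set_nonneg)
  finally have *: "?n y * ?n y \<le> (a * ?n v) * ?n y"
    by (simp add: power2_eq_square mult_ac)
  show "?n y \<le> a * ?n v" unfolding y_def[symmetric]
  proof (cases "?n y = 0")
    case False
    then have "?n y > 0" using L2_set_nonneg[of "\<lambda>s. cmod (y s)" "{..<d}"] by linarith
    then show ?thesis using * by (simp add: mult_le_cancel_right)
  qed (simp add: a L2_set_nonneg)
qed

text \<open>The part of \<open>A\<close> on the \<open>s\<close>-th block diagonal: \<open>s = 1\<close> is the subdiagonal \<open>\<alpha>\<close>, \<open>s = -1\<close> the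
  superdiagonal \<open>\<gamma>\<close>.\<close>

definition block_diagonal_part :: "bimat \<Rightarrow> int \<Rightarrow> nat \<Rightarrow> int \<Rightarrow> bimat" where
  "block_diagonal_part A c d s = (\<lambda>i j. if block_of c d i = block_of c d j + s then A i j else 0)"

lemma band_matrix_block_diagonal_part [simp]:
  assumes "band_matrix A"
  shows "band_matrix (block_diagonal_part A c d s)"
proof -
  obtain b K where b: "\<And>i j. \<bar>i - j\<bar> > int b \<Longrightarrow> A i j = 0" and K: "\<And>i j. cmod (A i j) \<le> K"
    using band_matrix_bounds[OF assms] by metis
  have K0: "0 \<le> K" using K[of 0 0] norm_ge_zero[of "A 0 0"] by linarith
  have "\<bar>i - j\<bar> \<le> int b" if "block_diagonal_part A c d s i j \<noteq> 0" for i j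
    using that b[of i j] by (force simp: block_diagonal_part_def split: if_splits)
  moreover have "cmod (block_diagonal_part A c d s i j) \<le> K" for i j
    using K K0 by (simp add: block_diagonal_part_def)
  then have "bounded (range (\<lambda>i. block_diagonal_part A c d s i (i + m)))" for m
    by (auto simp: bounded_iff)
  ultimately show ?thesis unfolding band_matrix_def by blast
qed

text \<open>A single block diagonal maps block \<open>i\<close> to block \<open>i + s\<close>, so the blocks do not interact.\<close>

lemma norm_block_diagonal_part_le:
  assumes A: "band_matrix A" and d: "d > 0" and "0 \<le> a"
    and bound: "\<And>i. mat_bound d (block_entry A c d (i + s) i) a"
  shows "norm (mat_op (block_diagonal_part A c d s) x) \<le> a * norm x"
proof (rule power2_le_imp_le)
  let ?y = "mat_op (block_diagonal_part A c d s) x"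
  let ?N = "block_norm_sq c d"
  have y: "seq ?y (c + int d * (i + s) + int r)
      = (\<Sum>t<d. block_entry A c d (i + s) i r t * seq x (c + int d * i + int t))"
    if r: "r < d" for i r
  proof -
    let ?B = "(\<lambda>t. c + int d * i + int t) ` {..<d}"
    have in_B: "j \<in> ?B" if "block_of c d j = i" for j
    proof (rule image_eqI[of _ _ "nat ((j - c) mod int d)"])
      have "j - c = int d * i + (j - c) mod int d"
        using that by (metis mult_div_mod_eq)
      then show "j = c + int d * i + int (nat ((j - c) mod int d))"
        using d by simp
    qed (use d in \<open>auto simp: nat_less_iff\<close>)
    define I where "I = c + int d * (i + s) + int r"
    have I: "block_of c d I = i + s"
      unfolding I_def by (rule block_of_index[OF r])
    have "block_of c d j = i \<longleftrightarrow> j \<in> ?B" for j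
      using in_B block_of_index by blast
    then have part: "block_diagonal_part A c d s I j = (if j \<in> ?B then A I j else 0)" for j
      unfolding block_diagonal_part_def I by (simp add: eq_commute)
    have "seq ?y I = (\<Sum>\<^sub>\<infinity>j. block_diagonal_part A c d s I j * seq x j)"
      by (rule seq_mat_op) (simp add: A)
    also have "\<dots> = (\<Sum>\<^sub>\<infinity>j\<in>?B. A I j * seq x j)"
      unfolding part by (rule infsum_cong_neutral) auto
    also have "\<dots> = (\<Sum>j\<in>?B. A I j * seq x j)"
      by simp
    also have "\<dots> = (\<Sum>t<d. block_entry A c d (i + s) i r t * seq x (c + int d * i + int t))"
      by (subst sum.reindex) (auto simp: inj_on_def block_entry_def I_def)
    finally show ?thesis unfolding I_def .
  qed
  have N: "?N ?y (i + s) \<le> a\<^sup>2 * ?N x i" for i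
  proof -
    let ?v = "\<lambda>t. seq x (c + int d * i + int t)"
    have "?N ?y (i + s) = (L2_set (\<lambda>r. cmod (\<Sum>t<d. block_entry A c d (i + s) i r t * ?v t)) {..<d})\<^sup>2"
      by (simp add: block_norm_sq_def y L2_set_def sum_nonneg)
    also have "\<dots> \<le> (a * L2_set (\<lambda>t. cmod (?v t)) {..<d})\<^sup>2"
      using bound[of i] unfolding mat_bound_def by (intro power_mono) (auto intro: L2_set_nonneg)
    also have "\<dots> = a\<^sup>2 * ?N x i"
      by (simp add: block_norm_sq_def L2_set_def sum_nonneg power_mult_distrib)
    finally show ?thesis .
  qed
  have "bij_betw (\<lambda>i. i + s) UNIV (UNIV :: int set)"
    by (rule bij_betw_byWitness[where f' = "\<lambda>i. i - s"]) auto
  then have "((\<lambda>i. ?N ?y (i + s)) has_sum (norm ?y)\<^sup>2) UNIV"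
    by (subst has_sum_reindex_bij_betw[of _ UNIV UNIV "?N ?y"]) (auto intro: block_norm_sq_has_sum[OF d])
  moreover have "((\<lambda>i. a\<^sup>2 * ?N x i) has_sum a\<^sup>2 * (norm x)\<^sup>2) UNIV"
    by (intro has_sum_cmult_right block_norm_sq_has_sum[OF d])
  ultimately show "(norm ?y)\<^sup>2 \<le> (a * norm x)\<^sup>2"
    unfolding power_mult_distrib by (rule has_sum_mono) (rule N)
qed (use \<open>0 \<le> a\<close> in simp)

section \<open>Sine weights and localisation\<close>

text \<open>The lowest eigenvector of the discrete Dirichlet Laplacian on \<open>n\<close> points. It minimises the ratio of
  the squared differences to the squared weights, which is what the constant in \<open>eps_seq\<close>
  measures.\<close>

definition sine_weight :: "nat \<Rightarrow> int \<Rightarrow> real" where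
  "sine_weight n m = (if 1 \<le> m \<and> m \<le> int n then sin (of_int m * (pi / (real n + 1))) else 0)"

text \<open>The sine vanishes at the boundary points \<open>0\<close> and \<open>n + 1\<close>.\<close>

lemma sine_weight_eq:
  assumes "0 \<le> m" "m \<le> int n + 1"
  shows "sine_weight n m = sin (of_int m * (pi / (real n + 1)))"
proof -
  have "m = 0 \<or> m = int n + 1 \<or> 1 \<le> m \<and> m \<le> int n" using assms by linarith
  then show ?thesis by (auto simp: sine_weight_def)
qed

text \<open>The summand telescopes because \<open>sin ((m + 1) t) + sin ((m - 1) t) = 2 cos t sin (m t)\<close>.\<close>

lemma sum_sin_differences:
  fixes t :: real
  shows "(\<Sum>m<N. (sin (real (Suc m) * t) - sin (real m * t))\<^sup>2 - (2 - 2 * cos t) * (sin (real m * t))\<^sup>2)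
           = (sin (real N * t))\<^sup>2 - sin (real N * t) * sin (real N * t - t)"
proof (induction N)
  case (Suc N)
  have "sin (real N * t + t) + sin (real N * t - t) = 2 * cos t * sin (real N * t)"
    by (simp add: sin_add sin_diff)
  then have s: "sin (real N * t - t) = 2 * cos t * sin (real N * t) - sin (real N * t + t)"
    by simp
  have e: "real (Suc N) * t = real N * t + t" by (simp add: algebra_simps)
  show ?case
    unfolding sum.lessThan_Suc Suc.IH e s add_diff_cancel_right' by (simp add: power2_eq_square algebra_simps)
qed simp

lemma sum_sq_sine_weight_differences:
  shows "(\<Sum>m\<in>{0..int n}. (sine_weight n m - sine_weight n (m + 1))\<^sup>2)
       = (2 * sin (pi / (2 * (real n + 1))))\<^sup>2 * (\<Sum>m\<in>{1..int n}. (sine_weight n m)\<^sup>2)" (is "?D = ?q * ?W")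
proof -
  define t where "t = pi / (real n + 1)"
  have reindex: "(\<Sum>m\<in>{0..int n}. f m) = (\<Sum>m<Suc n. f (int m))" for f :: "int \<Rightarrow> real"
    by (rule sum.reindex_bij_witness[of _ int nat]) auto
  have "real n + 1 = real (Suc n)" by simp
  then have "real (Suc n) * t = pi" unfolding t_def \<open>real n + 1 = real (Suc n)\<close> by (simp del: of_nat_Suc)
  then have "(\<Sum>m<Suc n. (sin (real (Suc m) * t) - sin (real m * t))\<^sup>2 - (2 - 2 * cos t) * (sin (real m * t))\<^sup>2) = 0"
    unfolding sum_sin_differences by simp
  then have "(\<Sum>m<Suc n. (sin (real (Suc m) * t) - sin (real m * t))\<^sup>2)
      = (2 - 2 * cos t) * (\<Sum>m<Suc n. (sin (real m * t))\<^sup>2)"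
    by (simp only: sum_subtractf sum_distrib_left[symmetric])
  moreover have "?D = (\<Sum>m<Suc n. (sin (real (Suc m) * t) - sin (real m * t))\<^sup>2)"
    unfolding reindex
    by (rule sum.cong) (auto simp: sine_weight_eq t_def power2_commute add.commute)
  moreover have "?W = (\<Sum>m\<in>{0..int n}. (sine_weight n m)\<^sup>2)"
    by (rule sum.mono_neutral_left) (auto simp: sine_weight_def)
  then have "?W = (\<Sum>m<Suc n. (sin (real m * t))\<^sup>2)"
    unfolding reindex by (simp add: sine_weight_eq t_def del: sum.lessThan_Suc)
  moreover have "t = 2 * (pi / (2 * (real n + 1)))"
    unfolding t_def times_divide_eq_right mult_divide_mult_cancel_left_if by simp
  then have "2 - 2 * cos t = ?q"
    by (simp only: cos_double_sin power_mult_distrib) simp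
  ultimately show ?thesis by simp
qed

definition block_tridiagonal :: "bimat \<Rightarrow> int \<Rightarrow> nat \<Rightarrow> bool" where
  "block_tridiagonal A c d \<longleftrightarrow> (\<forall>i j. A i j \<noteq> 0 \<longrightarrow> \<bar>block_of c d i - block_of c d j\<bar> \<le> 1)"

text \<open>Weights that depend on the block only commute with the diagonal blocks, so only the off-diagonal
  blocks contribute to the commutator, each with a first difference of \<open>w\<close>.\<close>

lemma mat_op_reweight_commutator:
  assumes A: "band_matrix A" and tri: "block_tridiagonal A c d"
    and M: "finite M" "\<And>m. m \<notin> M \<Longrightarrow> w m = 0"
  shows "mat_op A (reweight (\<lambda>j. w (block_of c d j - k)) x)
    = reweight (\<lambda>j. w (block_of c d j - k)) (mat_op A x)
      + mat_op (block_diagonal_part A c d 1)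
          (reweight (\<lambda>j. w (block_of c d j - k) - w (block_of c d j - k + 1)) x)
      + mat_op (block_diagonal_part A c d (- 1))
          (reweight (\<lambda>j. w (block_of c d j - k) - w (block_of c d j - k - 1)) x)"
    (is "?l = ?r")
proof (rule ell2_eqI)
  fix i
  obtain b K where b: "\<And>i j. \<bar>i - j\<bar> > int b \<Longrightarrow> A i j = 0" and "\<And>i j. cmod (A i j) \<le> K"
    using band_matrix_bounds[OF A] by metis
  have b': "\<bar>i - j\<bar> > int b \<Longrightarrow> block_diagonal_part A c d s i j = 0" for i j s
    by (simp add: block_diagonal_part_def b)
  let ?h = "\<lambda>j. block_of c d j - k"
  have fin: "finite (M \<union> (\<lambda>m. m - 1) ` M)" "finite (M \<union> (\<lambda>m. m + 1) ` M)"
    using M by auto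
  have "w m - w (m + 1) = 0" if "m \<notin> M \<union> (\<lambda>m. m - 1) ` M" for m
    using that M(2)[of m] M(2)[of "m + 1"] by (force simp: image_iff)
  then have s1: "seq (reweight (\<lambda>j. w (?h j) - w (?h j + 1)) y) j = of_real (w (?h j) - w (?h j + 1)) * seq y j" for y j
    by (rule seq_reweight[OF fin(1), where h = ?h and u = "\<lambda>m. w m - w (m + 1)"])
  have "w m - w (m - 1) = 0" if "m \<notin> M \<union> (\<lambda>m. m + 1) ` M" for m
    using that M(2)[of m] M(2)[of "m - 1"] by (force simp: image_iff)
  then have s2: "seq (reweight (\<lambda>j. w (?h j) - w (?h j - 1)) y) j = of_real (w (?h j) - w (?h j - 1)) * seq y j" for y j
    by (rule seq_reweight[OF fin(2), where h = ?h and u = "\<lambda>m. w m - w (m - 1)"])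
  have s0: "seq (reweight (\<lambda>j. w (?h j)) y) j = of_real (w (?h j)) * seq y j" for y j
    by (rule seq_reweight[OF M, where h = ?h])
  have f0: "seq (mat_op A y) i = (\<Sum>m\<in>{- int b..int b}. A i (i + m) * seq y (i + m))" for y
    by (rule seq_mat_op_finite_sum[OF A b])
  have f: "seq (mat_op (block_diagonal_part A c d s) y) i
      = (\<Sum>m\<in>{- int b..int b}. block_diagonal_part A c d s i (i + m) * seq y (i + m))" for s y
    by (rule seq_mat_op_finite_sum[OF band_matrix_block_diagonal_part[OF A] b'])
  have entry: "A i j * (of_real (w (?h j)) * y) = of_real (w (?h i)) * (A i j * y)
      + block_diagonal_part A c d 1 i j * (of_real (w (?h j) - w (?h j + 1)) * y)
      + block_diagonal_part A c d (- 1) i j * (of_real (w (?h j) - w (?h j - 1)) * y)" for j y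
  proof (cases "A i j = 0")
    case False
    then have "\<bar>block_of c d i - block_of c d j\<bar> \<le> 1"
      using tri by (simp add: block_tridiagonal_def)
    then consider (same) "block_of c d i = block_of c d j" | (below) "block_of c d i = block_of c d j + 1"
      | (above) "block_of c d i = block_of c d j - 1" by linarith
    then show ?thesis
    proof cases
      case below
      then have wi: "w (?h i) = w (?h j + 1)" by (intro arg_cong[of _ _ w]) simp
      show ?thesis unfolding wi using below by (simp add: block_diagonal_part_def left_diff_distrib right_diff_distrib)
    next
      case above
      then have wi: "w (?h i) = w (?h j - 1)" by (intro arg_cong[of _ _ w]) simp
      show ?thesis unfolding wi using above by (simp add: block_diagonal_part_def left_diff_distrib right_diff_distrib)
    qed (simp add: block_diagonal_part_def)
  qed (simp add: block_diagonal_part_def)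
  show "seq ?l i = seq ?r i"
    unfolding seq_add s0 f0 f s1 s2 entry by (simp only: sum.distrib sum_distrib_left)
qed

text \<open>The vectors \<open>E k x\<close>, which cut \<open>x\<close> down to the window starting after block \<open>k\<close> by means of the sine
  weights, are tested on average over \<open>k\<close>. In the \<open>l\<^sup>2\<close> norm over \<open>k\<close>, the family \<open>E k y\<close> has norm
  \<open>sqrt W * \<parallel>y\<parallel>\<close>, and by the commutator formula \<open>B (E k x)\<close> differs from \<open>E k (B x)\<close> by at most
  \<open>(a + g) * sqrt D * \<parallel>x\<parallel>\<close>, where \<open>W\<close> and \<open>D\<close> are the sums of the squared weights and of their squared
  differences. Since \<open>sqrt D = q * sqrt W\<close> with \<open>q = 2 sin (pi / (2 (n + 1)))\<close>, not all of the windows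
  can violate the claimed inequality.\<close>

lemma localisation_to_window:
  assumes B: "band_matrix B" and tri: "block_tridiagonal B c d" and d: "d > 0" and n: "n \<ge> 1"
    and a: "0 \<le> a" "\<And>i. mat_bound d (block_entry B c d (i + 1) i) a"
    and g: "0 \<le> g" "\<And>i. mat_bound d (block_entry B c d (i - 1) i) g"
    and e: "e > 0" and x: "norm (mat_op B x) < e * norm x"
  obtains k y where "y \<in> block_supported c d n k"
    "norm (mat_op B y) < (e + 2 * (a + g) * sin (pi / (2 * (real n + 1)))) * norm y"
proof -
  let ?w = "sine_weight n"
  let ?M = "{1..int n}"
  define q where "q = 2 * sin (pi / (2 * (real n + 1)))"
  define W where "W = (\<Sum>m\<in>?M. (?w m)\<^sup>2)"
  have q: "q \<ge> 0"
    unfolding q_def by (intro mult_nonneg_nonneg sin_ge_zero) (auto simp: field_simps)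
  have M: "?w m = 0" if "m \<notin> ?M" for m
    using that by (auto simp: sine_weight_def)
  have W: "W > 0"
  proof -
    have "0 < sin (1 * (pi / (real n + 1)))"
      using n by (intro sin_gt_zero) (auto simp: field_simps)
    then have "0 < (?w 1)\<^sup>2" using n by (simp add: sine_weight_def)
    also have "\<dots> \<le> W" unfolding W_def using n by (intro member_le_sum) auto
    finally show ?thesis .
  qed
  define E where "E k y = reweight (\<lambda>j. ?w (block_of c d j - k)) y" for k y
  define P where "P k = reweight (\<lambda>j. ?w (block_of c d j - k) - ?w (block_of c d j - k + 1)) x" for k
  define Q where "Q k = reweight (\<lambda>j. ?w (block_of c d j - k) - ?w (block_of c d j - k - 1)) x" for k
  define \<delta> where "\<delta> = (a + g) * q"
  have "\<exists>k. norm (mat_op B (E k x)) < (e + \<delta>) * norm (E k x)"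
  proof (rule ccontr)
    assume "\<not> ?thesis"
    then have low: "(e + \<delta>) * norm (E k x) \<le> norm (mat_op B (E k x))" for k
      by (simp add: not_less)
    have up: "norm (mat_op B (E k x)) \<le> norm (E k (mat_op B x)) + (a * norm (P k) + g * norm (Q k))" for k
    proof -
      have comm: "mat_op B (E k x) = E k (mat_op B x)
          + mat_op (block_diagonal_part B c d 1) (P k) + mat_op (block_diagonal_part B c d (- 1)) (Q k)"
        unfolding E_def P_def Q_def
        by (rule mat_op_reweight_commutator[OF B tri finite_atLeastAtMost_int M])
      have "norm (mat_op B (E k x)) \<le> norm (E k (mat_op B x))
          + norm (mat_op (block_diagonal_part B c d 1) (P k)) + norm (mat_op (block_diagonal_part B c d (- 1)) (Q k))"
        unfolding comm
        by (intro order_trans[OF norm_triangle_ineq] add_mono norm_triangle_ineq order_refl)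
      also have "\<dots> \<le> norm (E k (mat_op B x)) + a * norm (P k) + g * norm (Q k)"
        using a g by (intro add_mono norm_block_diagonal_part_le B d order_refl) auto
      finally show ?thesis by simp
    qed
    have L2E: "L2_set (\<lambda>k. norm (E k y)) F \<le> sqrt W * norm y" if "finite F" for F y
      unfolding E_def W_def
      by (rule L2_set_norm_windows_le[OF d finite_atLeastAtMost_int M that])
    have P0: "?w m - ?w (m + 1) = 0" if "m \<notin> {0..int n}" for m
      using that by (auto simp: sine_weight_def)
    have L2P: "L2_set (\<lambda>k. norm (P k)) F \<le> q * sqrt W * norm x" if "finite F" for F
      using L2_set_norm_windows_le[where u = "\<lambda>m. ?w m - ?w (m + 1)" and M = "{0..int n}" and c = c and x = x,
          OF d finite_atLeastAtMost_int P0 that] q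
      unfolding sum_sq_sine_weight_differences by (simp add: P_def W_def q_def real_sqrt_mult)
    have Q0: "?w m - ?w (m - 1) = 0" if "m \<notin> {1..int n + 1}" for m
      using that by (auto simp: sine_weight_def)
    have "(\<Sum>m\<in>{1..int n + 1}. (?w m - ?w (m - 1))\<^sup>2) = (\<Sum>m\<in>{0..int n}. (?w m - ?w (m + 1))\<^sup>2)"
      by (rule sum.reindex_bij_witness[of _ "\<lambda>m. m + 1" "\<lambda>m. m - 1"]) (auto simp: power2_commute)
    then have L2Q: "L2_set (\<lambda>k. norm (Q k)) F \<le> q * sqrt W * norm x" if "finite F" for F
      using L2_set_norm_windows_le[where u = "\<lambda>m. ?w m - ?w (m - 1)" and M = "{1..int n + 1}" and c = c and x = x,
          OF d finite_atLeastAtMost_int Q0 that] q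
      unfolding sum_sq_sine_weight_differences by (simp add: Q_def W_def q_def real_sqrt_mult)
    let ?R = "sqrt W * (norm (mat_op B x) + \<delta> * norm x)"
    have pos: "e + \<delta> > 0" using e q a g by (simp add: \<delta>_def add_pos_nonneg)
    have bound: "(e + \<delta>) * L2_set (\<lambda>k. norm (E k x)) F \<le> ?R" if F: "finite F" for F
    proof -
      have "(e + \<delta>) * L2_set (\<lambda>k. norm (E k x)) F = L2_set (\<lambda>k. (e + \<delta>) * norm (E k x)) F"
        using pos by (intro L2_set_right_distrib) simp
      also have "\<dots> \<le> L2_set (\<lambda>k. norm (E k (mat_op B x)) + (a * norm (P k) + g * norm (Q k))) F"
        using pos order_trans[OF low up] by (intro L2_set_mono) auto
      also have "\<dots> \<le> L2_set (\<lambda>k. norm (E k (mat_op B x))) F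
          + (L2_set (\<lambda>k. a * norm (P k)) F + L2_set (\<lambda>k. g * norm (Q k)) F)"
        by (intro order_trans[OF L2_set_triangle_ineq] add_left_mono L2_set_triangle_ineq)
      also have "\<dots> = L2_set (\<lambda>k. norm (E k (mat_op B x))) F
          + (a * L2_set (\<lambda>k. norm (P k)) F + g * L2_set (\<lambda>k. norm (Q k)) F)"
        using a g by (simp add: L2_set_right_distrib)
      also have "\<dots> \<le> sqrt W * norm (mat_op B x) + (a * (q * sqrt W * norm x) + g * (q * sqrt W * norm x))"
        using a g by (intro add_mono mult_left_mono L2E L2P L2Q F)
      also have "\<dots> = ?R" by (simp add: \<delta>_def algebra_simps)
      finally show ?thesis .
    qed
    have R: "?R \<ge> 0" using W q a g by (auto simp: \<delta>_def)
    have "((\<lambda>k. (norm (E k x))\<^sup>2) has_sum W * (norm x)\<^sup>2) UNIV"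
      unfolding E_def W_def by (rule sum_norm_sq_windows[OF d finite_atLeastAtMost_int M])
    then have "W * (norm x)\<^sup>2 \<le> (?R / (e + \<delta>))\<^sup>2"
    proof (rule has_sum_le_finite_sums)
      fix F :: "int set" assume "finite F"
      then have "sqrt (\<Sum>k\<in>F. (norm (E k x))\<^sup>2) \<le> ?R / (e + \<delta>)"
        using bound[of F] pos by (simp add: L2_set_def field_simps)
      then show "(\<Sum>k\<in>F. (norm (E k x))\<^sup>2) \<le> (?R / (e + \<delta>))\<^sup>2"
        using R pos by (simp add: sqrt_le_D)
    qed
    then have "(sqrt W * norm x)\<^sup>2 \<le> (?R / (e + \<delta>))\<^sup>2"
      using W by (simp add: power_mult_distrib)
    then have "sqrt W * norm x \<le> ?R / (e + \<delta>)"
      by (rule power2_le_imp_le) (use R pos in simp)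
    then have "sqrt W * ((e + \<delta>) * norm x) \<le> ?R"
      using pos by (simp add: field_simps)
    then have "(e + \<delta>) * norm x \<le> norm (mat_op B x) + \<delta> * norm x"
      using W by (simp only: mult_le_cancel_left_pos real_sqrt_gt_zero)
    then show False using x by (simp add: distrib_right)
  qed
  then obtain k where k: "norm (mat_op B (E k x)) < (e + \<delta>) * norm (E k x)" by blast
  show thesis
  proof (rule that)
    have "seq (E k x) j = of_real (?w (block_of c d j - k)) * seq x j" for j
      unfolding E_def by (rule seq_reweight[OF finite_atLeastAtMost_int M, where h = "\<lambda>j. block_of c d j - k"])
    then show "E k x \<in> block_supported c d n k"
      by (auto simp: block_supported_def sine_weight_def split: if_splits)
    show "norm (mat_op B (E k x)) < (e + 2 * (a + g) * sin (pi / (2 * (real n + 1)))) * norm (E k x)"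
      using k by (simp only: \<delta>_def q_def mult_ac)
  qed
qed

section \<open>Inclusions between pseudospectra and column sets\<close>

lemma in_pspec_cols_iff:
  assumes d: "d > 0" and n: "n \<ge> 1" and B: "band_matrix B"
  shows "z \<in> pspec_cols e B c d n k \<longleftrightarrow>
    (\<exists>x\<in>block_supported c d n k. norm (mat_op (minus_scalar B z) x) < e * norm x)"
proof -
  let ?V = "{x \<in> block_supported c d n k. norm x = 1}"
  let ?T = "mat_op (minus_scalar B z)"
  have "unit_seq (c + int d * (k + 1) + int 0) \<in> ?V"
  proof -
    have "block_of c d (c + int d * (k + 1) + int 0) = k + 1"
      by (rule block_of_index[OF d])
    then show ?thesis using n by (simp add: block_supported_def seq_unit_seq)
  qed
  then have ne: "?V \<noteq> {}" by blast
  have bdd: "bdd_below ((\<lambda>x. norm (?T x)) ` ?V)"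
    by (rule bdd_belowI2[of _ 0]) simp
  show ?thesis
  proof
    assume "z \<in> pspec_cols e B c d n k"
    then have "(INF x\<in>?V. norm (?T x)) < e"
      by (simp add: pspec_cols_def lower_norm_on_def)
    then obtain x where "x \<in> ?V" "norm (?T x) < e"
      using cINF_less_iff[OF ne bdd] by blast
    then show "\<exists>x\<in>block_supported c d n k. norm (?T x) < e * norm x" by force
  next
    assume "\<exists>x\<in>block_supported c d n k. norm (?T x) < e * norm x"
    then obtain x where x: "x \<in> block_supported c d n k" "norm (?T x) < e * norm x" by blast
    have nz: "norm x > 0"
      using x(2) linear_0[OF linear_mat_op[OF band_matrix_minus_scalar[OF B]]]
      by force
    let ?y = "(1 / norm x) *\<^sub>R x"
    have "?y \<in> ?V" using x(1) nz by (auto simp: block_supported_def seq_scaleR)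
    have "(INF x\<in>?V. norm (?T x)) \<le> norm (?T ?y)"
      by (rule cINF_lower[OF bdd]) fact
    also have "?T ?y = (1 / norm x) *\<^sub>R ?T x"
      by (rule linear_scale[OF linear_mat_op[OF band_matrix_minus_scalar[OF B]]])
    also have "norm \<dots> < e" using x(2) nz by (simp add: field_simps)
    finally show "z \<in> pspec_cols e B c d n k"
      by (simp add: pspec_cols_def lower_norm_on_def)
  qed
qed

lemma block_size_pos: "block_size A > 0"
  by (simp add: block_size_def)

text \<open>Indices whose blocks are two or more apart differ by more than the block length, which is at least
  the bandwidth.\<close>

lemma block_tridiagonal_block_size:
  assumes "band_matrix A"
  shows "block_tridiagonal A c (block_size A)"
  unfolding block_tridiagonal_def
proof (intro allI impI)
  fix i j assume nz: "A i j \<noteq> 0"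
  let ?S = "{nat \<bar>i - j\<bar> | i j. A i j \<noteq> 0}"
  let ?d = "int (block_size A)"
  obtain b K where b: "\<And>i j. \<bar>i - j\<bar> > int b \<Longrightarrow> A i j = 0" and "\<And>i j. cmod (A i j) \<le> K"
    using band_matrix_bounds[OF assms] by metis
  have "nat \<bar>i - j\<bar> \<le> b" if "A i j \<noteq> 0" for i j
    using b[of i j] that by force
  then have "bdd_above ?S" by (auto intro!: bdd_aboveI[of _ b])
  then have "nat \<bar>i - j\<bar> \<le> bandwidth A"
    unfolding bandwidth_def using nz by (intro cSup_upper) auto
  then have ij: "\<bar>(i - c) - (j - c)\<bar> \<le> ?d"
    by (auto simp: block_size_def)
  have d: "?d > 0" using block_size_pos[of A] by simp
  have 1: "(p + ?d) div ?d = p div ?d + 1" for p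
    using d by simp
  have "(i - c) div ?d \<le> (j - c) div ?d + 1" "(j - c) div ?d \<le> (i - c) div ?d + 1"
    unfolding 1[symmetric] using ij d by (intro zdiv_mono1; linarith)+
  then show "\<bar>block_of c (block_size A) i - block_of c (block_size A) j\<bar> \<le> 1"
    by linarith
qed

lemma
  assumes A: "band_matrix A"
  shows alpha_norm_nonneg: "0 \<le> alpha_norm A c"
    and gamma_norm_nonneg: "0 \<le> gamma_norm A c"
    and mat_bound_alpha_norm: "mat_bound (block_size A) (block_entry A c (block_size A) (i + 1) i) (alpha_norm A c)"
    and mat_bound_gamma_norm: "mat_bound (block_size A) (block_entry A c (block_size A) (i - 1) i) (gamma_norm A c)"
proof -
  let ?d = "block_size A"
  obtain b K where "\<And>i j. \<bar>i - j\<bar> > int b \<Longrightarrow> A i j = 0" and K: "\<And>i j. cmod (A i j) \<le> K"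
    using band_matrix_bounds[OF A] by metis
  have K': "cmod (block_entry A c ?d i j r s) \<le> K" for i j r s
    by (simp add: block_entry_def K)
  note m = matrix_norm_entries[where K = K and d = ?d, OF K']
  have bdd: "bdd_above (range (\<lambda>i. matrix_norm ?d (block_entry A c ?d (f i) i)))" for f
    by (rule bdd_aboveI2) (rule m(2))
  have up: "matrix_norm ?d (block_entry A c ?d (f i) i)
      \<le> (SUP i. matrix_norm ?d (block_entry A c ?d (f i) i))" for f i
    by (rule cSUP_upper[OF UNIV_I bdd])
  have mono: "mat_bound ?d M a'" if "mat_bound ?d M a" "a \<le> a'" for M a a'
    using that unfolding mat_bound_def by (meson mult_right_mono L2_set_nonneg order_trans)
  show "0 \<le> alpha_norm A c" "0 \<le> gamma_norm A c"
    using order_trans[OF m(3) up[of "\<lambda>i. i + 1" 0]] order_trans[OF m(3) up[of "\<lambda>i. i - 1" 0]]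
    by (simp_all add: alpha_norm_def gamma_norm_def)
  show "mat_bound ?d (block_entry A c ?d (i + 1) i) (alpha_norm A c)"
    unfolding alpha_norm_def by (rule mono[OF m(4) up[of "\<lambda>i. i + 1"]])
  show "mat_bound ?d (block_entry A c ?d (i - 1) i) (gamma_norm A c)"
    unfolding gamma_norm_def by (rule mono[OF m(4) up[of "\<lambda>i. i - 1"]])
qed

lemma mat_bound_minus_scalar:
  assumes "mat_bound d (block_entry A c d i j) a" "i \<noteq> j"
  shows "mat_bound d (block_entry (minus_scalar A z) c d i j) a"
proof -
  have "block_entry (minus_scalar A z) c d i j r s = block_entry A c d i j r s" if "r < d" "s < d" for r s
  proof -
    have "c + int d * i + int r \<noteq> c + int d * j + int s"
      using block_of_index[OF that(1), of c i] block_of_index[OF that(2), of c j] assms(2) by metis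
    then show ?thesis by (simp add: block_entry_def minus_scalar_def)
  qed
  then have "(\<Sum>s<d. block_entry (minus_scalar A z) c d i j r s * v s)
      = (\<Sum>s<d. block_entry A c d i j r s * v s)" if "r < d" for r v
    using that by (intro sum.cong) auto
  then show ?thesis
    using assms(1) unfolding mat_bound_def L2_set_def by simp
qed

lemma block_tridiagonal_minus_scalar:
  "block_tridiagonal A c d \<Longrightarrow> block_tridiagonal (minus_scalar A z) c d"
  by (auto simp: block_tridiagonal_def minus_scalar_def split: if_splits)

lemma block_tridiagonal_adj:
  "block_tridiagonal A c d \<Longrightarrow> block_tridiagonal (adj A) c d"
  unfolding block_tridiagonal_def adj_def by (subst abs_minus_commute) blast

lemma block_entry_adj: "block_entry (adj A) c d i j = (\<lambda>r s. block_entry A c d j i s r)"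
  by (simp add: block_entry_def adj_def)

text \<open>A near-eigenvector of \<open>A\<close> or of its adjoint is localised to a window. For the adjoint the two
  off-diagonals exchange their roles and their blocks are transposed.\<close>

lemma pspec_subset_cols:
  assumes A: "band_matrix A" and e: "e > 0" and n: "n \<ge> 1"
  shows "pspec e A \<subseteq> (\<Union>k. pspec_cols2 (e + eps_seq A c n) A c n k)"
proof
  let ?d = "block_size A"
  note d = block_size_pos[of A]
  note a = alpha_norm_nonneg[OF A, of c] and g = gamma_norm_nonneg[OF A, of c]
  note \<alpha> = mat_bound_alpha_norm[OF A, of c] and \<gamma> = mat_bound_gamma_norm[OF A, of c]
  note tri = block_tridiagonal_block_size[OF A, of c]
  have A': "band_matrix (adj A)" using A by simp
  fix z assume "z \<in> pspec e A"
  then consider x where "norm (mat_op (minus_scalar A z) x) < e * norm x"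
    | x where "norm (mat_op (minus_scalar (adj A) z) x) < e * norm x"
    unfolding in_pspec_iff[OF A e] by blast
  then show "z \<in> (\<Union>k. pspec_cols2 (e + eps_seq A c n) A c n k)"
  proof cases
    case 1
    obtain k y where "y \<in> block_supported c ?d n k"
      "norm (mat_op (minus_scalar A z) y) < (e + eps_seq A c n) * norm y"
      by (rule localisation_to_window[OF band_matrix_minus_scalar[OF A] block_tridiagonal_minus_scalar[OF tri]
            d n a mat_bound_minus_scalar[OF \<alpha>] g mat_bound_minus_scalar[OF \<gamma>] e 1])
        (auto simp: eps_seq_def)
    then show ?thesis
      unfolding pspec_cols2_def using in_pspec_cols_iff[OF d n A] by blast
  next
    case 2
    have \<gamma>': "mat_bound ?d (block_entry (adj A) c ?d (i + 1) i) (gamma_norm A c)" for i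
      using mat_bound_transpose[OF \<gamma>[of "i + 1"] g] by (simp add: block_entry_adj)
    have \<alpha>': "mat_bound ?d (block_entry (adj A) c ?d (i - 1) i) (alpha_norm A c)" for i
      using mat_bound_transpose[OF \<alpha>[of "i - 1"] a] by (simp add: block_entry_adj)
    obtain k y where "y \<in> block_supported c ?d n k"
      "norm (mat_op (minus_scalar (adj A) z) y) < (e + eps_seq A c n) * norm y"
      by (rule localisation_to_window[OF band_matrix_minus_scalar[OF A']
            block_tridiagonal_minus_scalar[OF block_tridiagonal_adj[OF tri]]
            d n g mat_bound_minus_scalar[OF \<gamma>'] a mat_bound_minus_scalar[OF \<alpha>'] e 2])
        (auto simp: eps_seq_def add.commute)
    then show ?thesis
      unfolding pspec_cols2_def using in_pspec_cols_iff[OF d n A'] by blast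
  qed
qed

lemma cols_subset_pspec:
  assumes A: "band_matrix A" and e: "e > 0" and n: "n \<ge> 1"
  shows "(\<Union>k. pspec_cols2 e A c n k) \<subseteq> pspec e A"
  using in_pspec_cols_iff[OF block_size_pos n] A in_pspec_iff[OF A e]
  by (auto simp: pspec_cols2_def)

section \<open>Hausdorff convergence\<close>

lemma hausdorff_distance_commute: "hausdorff_distance S T = hausdorff_distance T S"
  by (simp add: hausdorff_distance_def max.commute)

lemma hausdorff_distance_le:
  assumes "S \<subseteq> T" "S \<noteq> {}" "\<eta> \<ge> 0" "\<And>t. t \<in> T \<Longrightarrow> \<exists>s\<in>S. dist t s < \<eta>"
  shows "\<bar>hausdorff_distance S T\<bar> \<le> \<eta>"
proof -
  have "infdist s T = 0" if "s \<in> S" for s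
    using that assms(1) by auto
  then have 1: "(SUP s\<in>S. infdist s T) = 0" using assms(2) by simp
  have "infdist t S \<le> \<eta>" if "t \<in> T" for t
    using assms(4)[OF that] by (meson infdist_le2 less_imp_le)
  then have "(SUP t\<in>T. infdist t S) \<le> \<eta>"
    using assms(1,2) by (intro cSUP_least) auto
  then show ?thesis unfolding hausdorff_distance_def 1 using assms(3) by simp
qed

lemma eps_seq_nonneg:
  assumes "band_matrix A"
  shows "0 \<le> eps_seq A c n"
  unfolding eps_seq_def
  using alpha_norm_nonneg[OF assms, of c] gamma_norm_nonneg[OF assms, of c]
  by (intro mult_nonneg_nonneg add_nonneg_nonneg sin_ge_zero) (auto simp: field_simps)

lemma eps_seq_tendsto_zero: "eps_seq A c \<longlonglongrightarrow> 0"
proof -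
  have "(\<lambda>n. pi / 2 * (1 / real (Suc n))) \<longlonglongrightarrow> pi / 2 * 0"
    by (intro tendsto_intros LIMSEQ_Suc lim_1_over_n)
  moreover have "pi / 2 * (1 / real (Suc n)) = pi / (2 * (real n + 1))" for n
    by (simp only: of_nat_Suc times_divide_times_eq mult_1_right add.commute)
  ultimately have "(\<lambda>n. pi / (2 * (real n + 1))) \<longlonglongrightarrow> 0" by (simp only: mult_zero_right)
  then have "(\<lambda>n. 2 * (alpha_norm A c + gamma_norm A c) * sin (pi / (2 * (real n + 1))))
      \<longlonglongrightarrow> 2 * (alpha_norm A c + gamma_norm A c) * sin 0"
    by (intro tendsto_intros)
  then show ?thesis by (simp add: eps_seq_def[abs_def])
qed

lemma hausdorff_convergesI:
  assumes T: "T \<noteq> {}" "bounded T" and ev: "\<forall>\<^sub>F n in sequentially. S n \<noteq> {} \<and> bounded (S n)"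
    and near: "\<And>\<eta>. \<eta> > 0 \<Longrightarrow> \<forall>\<^sub>F n in sequentially. \<bar>hausdorff_distance (S n) T\<bar> \<le> \<eta>"
  shows "hausdorff_converges S T"
  unfolding hausdorff_converges_def
proof (intro conjI T ev)
  show "(\<lambda>n. hausdorff_distance (S n) T) \<longlonglongrightarrow> 0"
  proof (rule tendstoI)
    fix \<eta> :: real assume "\<eta> > 0"
    then have "\<forall>\<^sub>F n in sequentially. \<bar>hausdorff_distance (S n) T\<bar> \<le> \<eta> / 2"
      by (intro near) simp
    then show "\<forall>\<^sub>F n in sequentially. dist (hausdorff_distance (S n) T) 0 < \<eta>"
      by eventually_elim (use \<open>\<eta> > 0\<close> in simp)
  qed
qed

theorem proposition5p2:
  fixes A :: "int \<Rightarrow> int \<Rightarrow> complex" and c :: int and \<epsilon> :: real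
  assumes "band_matrix A" and "\<epsilon> > 0"
  shows "(\<forall>n\<ge>1. (\<Union>k. pspec_cols2 \<epsilon> A c n k) \<subseteq> pspec \<epsilon> A) \<and>
    (\<forall>n\<ge>1. pspec \<epsilon> A \<subseteq> (\<Union>k. pspec_cols2 (\<epsilon> + eps_seq A c n) A c n k)) \<and>
    hausdorff_converges (\<lambda>n. \<Union>k. pspec_cols2 \<epsilon> A c n k) (pspec \<epsilon> A) \<and>
    hausdorff_converges (\<lambda>n. \<Union>k. pspec_cols2 (\<epsilon> + eps_seq A c n) A c n k) (pspec \<epsilon> A)"
proof -
  note A = \<open>band_matrix A\<close> and pos = \<open>\<epsilon> > 0\<close>
  let ?S = "\<lambda>n. \<Union>k. pspec_cols2 \<epsilon> A c n k"
  let ?U = "\<lambda>n. \<Union>k. pspec_cols2 (\<epsilon> + eps_seq A c n) A c n k"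
  let ?T = "pspec \<epsilon> A"
  have eps0: "eps_seq A c n \<ge> 0" for n by (rule eps_seq_nonneg[OF A])
  have sub: "?S n \<subseteq> ?T" if "n \<ge> 1" for n by (rule cols_subset_pspec[OF A pos that])
  have sup: "?T \<subseteq> ?U n" if "n \<ge> 1" for n by (rule pspec_subset_cols[OF A pos that])
  have outer: "?U n \<subseteq> pspec (\<epsilon> + eps_seq A c n) A" if "n \<ge> 1" for n
    using cols_subset_pspec[OF A _ that] pos eps0[of n] by (simp add: add_pos_nonneg)
  \<comment> \<open>The upper inclusion at the level \<open>\<epsilon> - eps_seq A c n\<close>: column sets of level \<open>\<epsilon>\<close> contain a
    slightly smaller pseudospectrum.\<close>
  have inner: "pspec (\<epsilon> - eps_seq A c n) A \<subseteq> ?S n" if "n \<ge> 1" "eps_seq A c n < \<epsilon>" for n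
    using pspec_subset_cols[OF A _ that(1), of "\<epsilon> - eps_seq A c n" c] that(2) by simp
  have T: "?T \<noteq> {}" "bounded ?T"
    using pspec_nonempty[OF A pos] bounded_pspec[OF A pos] by auto
  have ev1: "\<forall>\<^sub>F n in sequentially. n \<ge> (1::nat)" by (rule eventually_ge_at_top)
  have ev2: "\<forall>\<^sub>F n in sequentially. eps_seq A c n < \<epsilon>"
    using order_tendstoD(2)[OF eps_seq_tendsto_zero pos] .
  have lim1: "(\<lambda>n. \<epsilon> - eps_seq A c n) \<longlonglongrightarrow> \<epsilon>"
    using tendsto_diff[OF tendsto_const eps_seq_tendsto_zero, of \<epsilon>] by simp
  have lim2: "(\<lambda>n. \<epsilon> + eps_seq A c n) \<longlonglongrightarrow> \<epsilon>"
    using tendsto_add[OF tendsto_const eps_seq_tendsto_zero, of \<epsilon>] by simp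
  have evS: "\<forall>\<^sub>F n in sequentially. ?S n \<noteq> {} \<and> bounded (?S n)"
    using ev1 ev2
  proof eventually_elim
    case (elim n)
    have "pspec (\<epsilon> - eps_seq A c n) A \<noteq> {}"
      using elim by (intro pspec_nonempty A) simp
    then have "?S n \<noteq> {}" using inner[OF elim] by (metis subset_empty)
    moreover have "bounded (?S n)" by (rule bounded_subset[OF T(2) sub[OF elim(1)]])
    ultimately show ?case by blast
  qed
  have "hausdorff_converges ?S ?T"
  proof (rule hausdorff_convergesI[OF T evS])
    fix \<eta> :: real assume \<eta>: "\<eta> > 0"
    show "\<forall>\<^sub>F n in sequentially. \<bar>hausdorff_distance (?S n) ?T\<bar> \<le> \<eta>"
      using ev1 ev2 evS pspec_eventually_near[OF A pos \<eta> tendsto_const lim1]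
    proof eventually_elim
      case (elim n)
      show ?case
      proof (rule hausdorff_distance_le[OF sub[OF elim(1)]])
        show "?S n \<noteq> {}" using elim(3) by (rule conjunct1)
        show "\<exists>s\<in>?S n. dist t s < \<eta>" if "t \<in> ?T" for t
          using bspec[OF elim(4) that] inner[OF elim(1,2)] by (meson subsetD)
      qed (use \<eta> in simp)
    qed
  qed
  moreover have "hausdorff_converges ?U ?T"
  proof (rule hausdorff_convergesI[OF T])
    show "\<forall>\<^sub>F n in sequentially. ?U n \<noteq> {} \<and> bounded (?U n)"
      using ev1
    proof eventually_elim
      case (elim n)
      have "bounded (pspec (\<epsilon> + eps_seq A c n) A)"
        using bounded_pspec[OF A] pos eps0[of n] by (simp add: add_pos_nonneg)
      then show ?case
        using sup[OF elim] T(1) bounded_subset[OF _ outer[OF elim]] by (metis subset_empty)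
    qed
    fix \<eta> :: real assume \<eta>: "\<eta> > 0"
    show "\<forall>\<^sub>F n in sequentially. \<bar>hausdorff_distance (?U n) ?T\<bar> \<le> \<eta>"
      using ev1 pspec_eventually_near[OF A pos \<eta> lim2 tendsto_const]
    proof eventually_elim
      case (elim n)
      show ?case
        unfolding hausdorff_distance_commute[of "?U n"]
      proof (rule hausdorff_distance_le[OF sup[OF elim(1)] T(1)])
        show "\<exists>s\<in>?T. dist t s < \<eta>" if "t \<in> ?U n" for t
          using elim(2) subsetD[OF outer[OF elim(1)] that] by (rule bspec)
      qed (use \<eta> in simp)
    qed
  qed
  ultimately show ?thesis
    using sub sup by (intro conjI allI impI)
qed

end
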